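(* Let $\mathcal{T}$ be a Krull-Schmidt, Hom-finite triangulated category over $k$ with shift functor $[1]$, let $R$ be an object of $\mathcal{T}$, and let $X$ be an object in $\operatorname{pr}(R)$. (1) If $R$ is a presilting object, then the following are equivalent: (a) $X$ is an $R[1]$-rigid object; (b) $X$ is a rigid object; (c) $X$ is a presilting object. (2) If $R$ is a silting object, then $X$ is a maximal $R[1]$-rigid object with respect to $\operatorname{pr}(R)$ if and only if $X$ is a silting object.
   Context: $k$ is an algebraically closed field. $\operatorname{add}M$ is the full subcategory of finite direct sums of direct summands of $M$. For objects $X,Y,Z$ of $\mathcal{T}$, $Z(X,Y)\subseteq\operatorname{Hom}_{\mathcal{T}}(X,Y)$ denotes the subgroup of morphisms that factor through an object of $\operatorname{add}Z$. An object $X\in\mathcal{T}$ is rigid if $\operatorname{Hom}_{\mathcal{T}}(X,X[1])=0$. It is presilting if $\operatorname{Hom}_{\mathcal{T}}(X,X[i])=0$ for all $i>0$, and silting if it is presilting and the smallest thick subcategory of $\mathcal{T}$ containing $X$ is $\mathcal{T}$. (Presilting objects are rigid.) For a rigid object $R$: $\operatorname{pr}(R)$ is the full subcategory of $\mathcal{T}$ of objects $X$ for which there is a triangle $R_1\to R_0\to X\to R_1[1]$ with $R_0,R_1\in\operatorname{add}R$. An object $X\in\mathcal{T}$ is $R[1]$-rigid if $R[1](X,X[1])=0$. An object $X\in\operatorname{pr}(R)$ is maximal $R[1]$-rigid with respect to $\operatorname{pr}(R)$ if $X$ is $R[1]$-rigid and, for every $Z\in\operatorname{pr}(R)$ with $R[1](X\oplus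 Z,X[1]\oplus Z[1])=0$, one has $Z\in\operatorname{add}X$. *)

theory Defs
  imports "HOL-Computational_Algebra.Polynomial"
begin

section \<open>Linear categories\<close>

text \<open>
  All elements of the type \<open>'o\<close> are objects. All morphisms live in one ambient vector space \<open>'m\<close>,
  of which every \<open>Hom T X Y\<close> is a linear subspace. This is no restriction: for a given linear
  category take \<open>'m\<close> to be the direct sum of all its Hom spaces. Nothing is required of elements
  of \<open>'m\<close> outside the Hom spaces. The Hom spaces all share the element 0, so a morphism need not
  determine its source and target; these are always given explicitly.
  \<open>g \<bullet> f\<close> means first \<open>f\<close>, then \<open>g\<close>.
\<close>

record ('k, 'o, 'm) linear_cat =
  Scale :: "'k \<Rightarrow> 'm \<Rightarrow> 'm"
  Hom   :: "'o \<Rightarrow> 'o \<Rightarrow> 'm set"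
  Ident :: "'o \<Rightarrow> 'm"
  Comp  :: "'m \<Rightarrow> 'm \<Rightarrow> 'm" (infixr \<open>\<bullet>\<index>\<close> 70)

locale linear_category = vector_space "Scale T"
  for T :: "('k::field, 'o, 'm::ab_group_add, 'z) linear_cat_scheme" (structure) +
  assumes subspace_Hom: "subspace (Hom T X Y)"
    and Ident_in_Hom: "Ident T X \<in> Hom T X X"
    and Comp_in_Hom: "f \<in> Hom T X Y \<Longrightarrow> g \<in> Hom T Y Z \<Longrightarrow> g \<bullet> f \<in> Hom T X Z"
    and Comp_Ident_right: "f \<in> Hom T X Y \<Longrightarrow> f \<bullet> Ident T X = f"
    and Comp_Ident_left: "f \<in> Hom T X Y \<Longrightarrow> Ident T Y \<bullet> f = f"
    and Comp_assoc: "f \<in> Hom T W X \<Longrightarrow> g \<in> Hom T X Y \<Longrightarrow> h \<in> Hom T Y Z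
                     \<Longrightarrow> (h \<bullet> g) \<bullet> f = h \<bullet> (g \<bullet> f)"
    and Comp_add_right: "f \<in> Hom T X Y \<Longrightarrow> f' \<in> Hom T X Y \<Longrightarrow> g \<in> Hom T Y Z
                     \<Longrightarrow> g \<bullet> (f + f') = g \<bullet> f + g \<bullet> f'"
    and Comp_add_left: "f \<in> Hom T X Y \<Longrightarrow> g \<in> Hom T Y Z \<Longrightarrow> g' \<in> Hom T Y Z
                     \<Longrightarrow> (g + g') \<bullet> f = g \<bullet> f + g' \<bullet> f"
    and Comp_Scale_right: "f \<in> Hom T X Y \<Longrightarrow> g \<in> Hom T Y Z
                     \<Longrightarrow> g \<bullet> Scale T c f = Scale T c (g \<bullet> f)"
    and Comp_Scale_left: "f \<in> Hom T X Y \<Longrightarrow> g \<in> Hom T Y Z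
                     \<Longrightarrow> Scale T c g \<bullet> f = Scale T c (g \<bullet> f)"

definition is_iso :: "('k, 'o, 'm, 'z) linear_cat_scheme \<Rightarrow> 'o \<Rightarrow> 'o \<Rightarrow> 'm \<Rightarrow> bool" where
  "is_iso T X Y f \<longleftrightarrow> f \<in> Hom T X Y \<and>
     (\<exists>g\<in>Hom T Y X. g \<bullet>\<^bsub>T\<^esub> f = Ident T X \<and> f \<bullet>\<^bsub>T\<^esub> g = Ident T Y)"

definition isomorphic :: "('k, 'o, 'm, 'z) linear_cat_scheme \<Rightarrow> 'o \<Rightarrow> 'o \<Rightarrow> bool" where
  "isomorphic T X Y \<longleftrightarrow> (\<exists>f. is_iso T X Y f)"

definition zero_object :: "('k, 'o, 'm::ab_group_add, 'z) linear_cat_scheme \<Rightarrow> 'o \<Rightarrow> bool" where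
  "zero_object T Z \<longleftrightarrow> (\<forall>X. Hom T X Z = {0} \<and> Hom T Z X = {0})"

text \<open>
  \<open>P\<close> is a finite direct sum (biproduct) of the list of objects \<open>Xs\<close>, with injections \<open>\<iota> a\<close> and
  projections \<open>\<pi> a\<close>. For the empty list this says that \<open>P\<close> is a zero object.
\<close>

definition is_direct_sum ::
    "('k, 'o, 'm::ab_group_add, 'z) linear_cat_scheme \<Rightarrow> 'o \<Rightarrow> 'o list \<Rightarrow> bool" where
  "is_direct_sum T P Xs \<longleftrightarrow>
     (\<exists>\<iota> \<pi>. (\<forall>a<length Xs. \<iota> a \<in> Hom T (Xs ! a) P \<and> \<pi> a \<in> Hom T P (Xs ! a)) \<and>
        (\<forall>a<length Xs. \<forall>b<length Xs.
           \<pi> a \<bullet>\<^bsub>T\<^esub> \<iota> b = (if a = b then Ident T (Xs ! a) else 0)) \<and>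
        (\<Sum>a<length Xs. \<iota> a \<bullet>\<^bsub>T\<^esub> \<pi> a) = Ident T P)"

text \<open>
  A chosen direct sum \<open>X \<oplus> Y\<close>; in an additive category it exists and is unique up to isomorphism.
\<close>

definition dsum :: "('k, 'o, 'm::ab_group_add, 'z) linear_cat_scheme \<Rightarrow> 'o \<Rightarrow> 'o \<Rightarrow> 'o"
    (infixr \<open>\<oplus>\<index>\<close> 65) where
  "X \<oplus>\<^bsub>T\<^esub> Y = (SOME P. is_direct_sum T P [X, Y])"

definition direct_summand ::
    "('k, 'o, 'm::ab_group_add, 'z) linear_cat_scheme \<Rightarrow> 'o \<Rightarrow> 'o \<Rightarrow> bool" where
  "direct_summand T N M \<longleftrightarrow> (\<exists>N'. is_direct_sum T M [N, N'])"

definition add :: "('k, 'o, 'm::ab_group_add, 'z) linear_cat_scheme \<Rightarrow> 'o \<Rightarrow> 'o set" where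
  "add T M = {P. \<exists>Xs. is_direct_sum T P Xs \<and> (\<forall>N\<in>set Xs. direct_summand T N M)}"

text \<open>The morphisms from \<open>X\<close> to \<open>Y\<close> that factor through \<open>add Z\<close>, written \<open>Z(X, Y)\<close>.\<close>

definition factoring ::
    "('k, 'o, 'm::ab_group_add, 'z) linear_cat_scheme \<Rightarrow> 'o \<Rightarrow> 'o \<Rightarrow> 'o \<Rightarrow> 'm set" where
  "factoring T Z X Y =
     {g \<bullet>\<^bsub>T\<^esub> f | f g W. W \<in> add T Z \<and> f \<in> Hom T X W \<and> g \<in> Hom T W Y}"

definition Hom_finite ::
    "('k::field, 'o, 'm::ab_group_add, 'z) linear_cat_scheme \<Rightarrow> bool" where
  "Hom_finite T \<longleftrightarrow> (\<forall>X Y. \<exists>B. finite B \<and> module.span (Scale T) B = Hom T X Y)"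

text \<open>
  The endomorphism ring of \<open>X\<close> is local: it is nonzero and the sum of two non-units is a non-unit.
\<close>

definition local_End :: "('k, 'o, 'm::ab_group_add, 'z) linear_cat_scheme \<Rightarrow> 'o \<Rightarrow> bool" where
  "local_End T X \<longleftrightarrow> Ident T X \<noteq> 0 \<and>
     (\<forall>f\<in>Hom T X X. \<forall>g\<in>Hom T X X.
        \<not> is_iso T X X f \<and> \<not> is_iso T X X g \<longrightarrow> \<not> is_iso T X X (f + g))"

definition Krull_Schmidt :: "('k, 'o, 'm::ab_group_add, 'z) linear_cat_scheme \<Rightarrow> bool" where
  "Krull_Schmidt T \<longleftrightarrow> (\<forall>X. \<exists>Xs. is_direct_sum T X Xs \<and> (\<forall>Y\<in>set Xs. local_End T Y))"

section \<open>Triangulated categories\<close>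

text \<open>
  \<open>Shift\<close> and \<open>ShiftM\<close> are the shift functor on objects and on morphisms, and
  \<open>Tri T X Y Z f g h\<close> says that \<open>X \<rightarrow> Y \<rightarrow> Z \<rightarrow> X[1]\<close>, with maps \<open>f\<close>, \<open>g\<close>, \<open>h\<close>, is a
  (distinguished) triangle.
\<close>

record ('k, 'o, 'm) tri_cat = "('k, 'o, 'm) linear_cat" +
  Shift  :: "'o \<Rightarrow> 'o"
  ShiftM :: "'m \<Rightarrow> 'm"
  Tri    :: "'o \<Rightarrow> 'o \<Rightarrow> 'o \<Rightarrow> 'm \<Rightarrow> 'm \<Rightarrow> 'm \<Rightarrow> bool"

text \<open>
  The shift is a linear autoequivalence (fully faithful and essentially surjective); this includes
  the case where it is an automorphism. The triangle axioms are those of Verdier, with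
  the octahedral axiom \<open>TR4\<close>.
\<close>

locale triangulated_category = linear_category T
  for T :: "('k::field, 'o, 'm::ab_group_add, 'z) tri_cat_scheme" (structure) +
  assumes direct_sums: "\<exists>P. is_direct_sum T P Xs"
    and ShiftM_Ident: "ShiftM T (Ident T X) = Ident T (Shift T X)"
    and ShiftM_Comp: "f \<in> Hom T X Y \<Longrightarrow> g \<in> Hom T Y Z
                      \<Longrightarrow> ShiftM T (g \<bullet> f) = ShiftM T g \<bullet> ShiftM T f"
    and ShiftM_add: "f \<in> Hom T X Y \<Longrightarrow> g \<in> Hom T X Y
                      \<Longrightarrow> ShiftM T (f + g) = ShiftM T f + ShiftM T g"
    and ShiftM_Scale: "f \<in> Hom T X Y \<Longrightarrow> ShiftM T (Scale T c f) = Scale T c (ShiftM T f)"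
    and ShiftM_bij: "bij_betw (ShiftM T) (Hom T X Y) (Hom T (Shift T X) (Shift T Y))"
    and Shift_ess_surj: "\<exists>X. isomorphic T (Shift T X) Y"
    and Tri_in_Hom: "Tri T X Y Z f g h
                      \<Longrightarrow> f \<in> Hom T X Y \<and> g \<in> Hom T Y Z \<and> h \<in> Hom T Z (Shift T X)"
    and TR1_iso: "Tri T X Y Z f g h \<Longrightarrow>
                    is_iso T X X' u \<Longrightarrow> is_iso T Y Y' v \<Longrightarrow> is_iso T Z Z' w \<Longrightarrow>
                    f' \<in> Hom T X' Y' \<Longrightarrow> g' \<in> Hom T Y' Z' \<Longrightarrow> h' \<in> Hom T Z' (Shift T X') \<Longrightarrow>
                    v \<bullet> f = f' \<bullet> u \<Longrightarrow> w \<bullet> g = g' \<bullet> v \<Longrightarrow> ShiftM T u \<bullet> h = h' \<bullet> w \<Longrightarrow>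
                    Tri T X' Y' Z' f' g' h'"
    and TR1_Ident: "zero_object T Z \<Longrightarrow> Tri T X X Z (Ident T X) 0 0"
    and TR1_cone: "f \<in> Hom T X Y \<Longrightarrow> \<exists>Z g h. Tri T X Y Z f g h"
    and TR2: "f \<in> Hom T X Y \<Longrightarrow> g \<in> Hom T Y Z \<Longrightarrow> h \<in> Hom T Z (Shift T X) \<Longrightarrow>
                Tri T X Y Z f g h \<longleftrightarrow> Tri T Y Z (Shift T X) g h (- ShiftM T f)"
    and TR3: "Tri T X Y Z f g h \<Longrightarrow> Tri T X' Y' Z' f' g' h' \<Longrightarrow>
                u \<in> Hom T X X' \<Longrightarrow> v \<in> Hom T Y Y' \<Longrightarrow> v \<bullet> f = f' \<bullet> u \<Longrightarrow>
                \<exists>w\<in>Hom T Z Z'. w \<bullet> g = g' \<bullet> v \<and> ShiftM T u \<bullet> h = h' \<bullet> w"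
    and TR4: "Tri T X Y Z' f i i' \<Longrightarrow> Tri T Y Z X' g j j' \<Longrightarrow> Tri T X Z Y' (g \<bullet> f) k k' \<Longrightarrow>
                \<exists>u v. Tri T Z' Y' X' u v (ShiftM T i \<bullet> j') \<and>
                  u \<bullet> i = k \<bullet> g \<and> k' \<bullet> u = i' \<and>
                  v \<bullet> k = j \<and> j' \<bullet> v = ShiftM T f \<bullet> k'"

definition rigid :: "('k, 'o, 'm::ab_group_add, 'z) tri_cat_scheme \<Rightarrow> 'o \<Rightarrow> bool" where
  "rigid T X \<longleftrightarrow> Hom T X (Shift T X) = {0}"

definition presilting :: "('k, 'o, 'm::ab_group_add, 'z) tri_cat_scheme \<Rightarrow> 'o \<Rightarrow> bool" where
  "presilting T X \<longleftrightarrow> (\<forall>i>0. Hom T X ((Shift T ^^ i) X) = {0})"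

text \<open>
  Since \<open>C\<close> is closed under isomorphism, closure under \<open>[1]\<close> and \<open>[-1]\<close> is the equivalence below.
\<close>

definition thick :: "('k, 'o, 'm::ab_group_add, 'z) tri_cat_scheme \<Rightarrow> 'o set \<Rightarrow> bool" where
  "thick T C \<longleftrightarrow> C \<noteq> {} \<and>
     (\<forall>X Y. X \<in> C \<and> isomorphic T X Y \<longrightarrow> Y \<in> C) \<and>
     (\<forall>X. Shift T X \<in> C \<longleftrightarrow> X \<in> C) \<and>
     (\<forall>X Y Z f g h. Tri T X Y Z f g h \<and> X \<in> C \<and> Y \<in> C \<longrightarrow> Z \<in> C) \<and>
     (\<forall>M N. M \<in> C \<and> direct_summand T N M \<longrightarrow> N \<in> C)"

definition thick_closure :: "('k, 'o, 'm::ab_group_add, 'z) tri_cat_scheme \<Rightarrow> 'o \<Rightarrow> 'o set" where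
  "thick_closure T X = \<Inter>{C. thick T C \<and> X \<in> C}"

definition silting :: "('k, 'o, 'm::ab_group_add, 'z) tri_cat_scheme \<Rightarrow> 'o \<Rightarrow> bool" where
  "silting T X \<longleftrightarrow> presilting T X \<and> thick_closure T X = UNIV"

definition pr :: "('k, 'o, 'm::ab_group_add, 'z) tri_cat_scheme \<Rightarrow> 'o \<Rightarrow> 'o set" where
  "pr T R = {X. \<exists>R1 R0 f g h. R1 \<in> add T R \<and> R0 \<in> add T R \<and> Tri T R1 R0 X f g h}"

definition shift_rigid ::
    "('k, 'o, 'm::ab_group_add, 'z) tri_cat_scheme \<Rightarrow> 'o \<Rightarrow> 'o \<Rightarrow> bool" where
  "shift_rigid T R X \<longleftrightarrow> factoring T (Shift T R) X (Shift T X) = {0}"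

definition maximal_shift_rigid ::
    "('k, 'o, 'm::ab_group_add, 'z) tri_cat_scheme \<Rightarrow> 'o \<Rightarrow> 'o \<Rightarrow> bool" where
  "maximal_shift_rigid T R X \<longleftrightarrow> X \<in> pr T R \<and> shift_rigid T R X \<and>
     (\<forall>Z\<in>pr T R.
        factoring T (Shift T R) (X \<oplus>\<^bsub>T\<^esub> Z) (Shift T X \<oplus>\<^bsub>T\<^esub> Shift T Z) = {0} \<longrightarrow>
        Z \<in> add T X)"

end

theory Submission
  imports Defs
begin

text \<open>
  Write \<open>W \<in> right_perp S\<close> if \<open>Hom(S, W[i]) = 0\<close> for all \<open>i > 0\<close>; thus \<open>S\<close> is presilting iff
  \<open>S \<in> right_perp S\<close>. Nearly every step below shows that some Hom space vanishes because it lies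
  between two vanishing ones in the long exact sequence of a triangle.

  If \<open>R\<close> is presilting and \<open>X\<close>, \<open>Y\<close> lie in \<open>pr R\<close>, so that there is a triangle
  \<open>R0 \<rightarrow> X \<rightarrow> R1[1] \<rightarrow> R0[1]\<close>, then \<open>Y \<in> right_perp R\<close> (\<open>pr_right_perp\<close>). Hence
  \<open>Hom(X, Y[i]) = 0\<close> for \<open>i \<ge> 2\<close> (\<open>pr_Hom_vanish\<close>), while a map \<open>X \<rightarrow> Y[1]\<close> vanishes on \<open>R0\<close> and so
  factors through \<open>R1[1]\<close> (\<open>pr_factoring\<close>). So the only possible obstruction to \<open>Y \<in> right_perp X\<close>
  is the space of maps \<open>X \<rightarrow> Y[1]\<close> that factor through \<open>add R[1]\<close>. With \<open>Y = X\<close> this makes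
  \<open>R[1]\<close>-rigid, rigid and presilting equivalent.

  The heart of the second part is \<open>silting_absorbs\<close>: if \<open>S\<close> is silting, \<open>Z \<in> right_perp S\<close> and
  \<open>S \<in> right_perp Z\<close>, then \<open>Z \<in> add S\<close>. Take right \<open>add S\<close>-approximations again and again: their
  cocones \<open>Z_1, Z_2, ...\<close> stay in \<open>right_perp S\<close>, and \<open>Hom(Z, Z_1[1])\<close> embeds successively into
  \<open>Hom(Z, Z_n[n])\<close>. The objects \<open>Y\<close> that have, from some \<open>n\<close> on, no nonzero maps to \<open>W[n]\<close> for any
  \<open>W \<in> right_perp S\<close> form a thick subcategory containing \<open>S\<close>
  (\<open>thick_eventually_vanishing\<close>), hence everything. So \<open>Hom(Z, Z_1[1]) = 0\<close>, the first approximation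
  splits, and the Krull-Schmidt property puts \<open>Z\<close> into \<open>add S\<close>.

  This is used in two ways. Applied to \<open>X\<close>, it says that a silting \<open>X\<close> is maximal. Applied to \<open>R\<close>,
  it shows that \<open>pr R\<close> contains every \<open>Y\<close> with \<open>Hom(R, Y[i]) = 0\<close> for \<open>i > 0\<close> and
  \<open>Hom(Y, R[i]) = 0\<close> for \<open>i > 1\<close> (\<open>silting_pr_if_vanishing\<close>); both conditions visibly pass to
  extensions. Conversely, let \<open>X\<close> be maximal and complete a right \<open>add X\<close>-approximation
  \<open>P \<rightarrow> R[1]\<close> to a triangle \<open>R \<rightarrow> U \<rightarrow> P \<rightarrow> R[1]\<close>, as in Bongartz's completion of partial tilting
  modules. Then \<open>U \<in> pr R\<close>, and there are no nonzero maps from \<open>X \<oplus> U\<close> to \<open>X[1] \<oplus> U[1]\<close>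
  (\<open>bongartz_completion\<close>), so \<open>U \<in> add X\<close> by maximality, and the triangle shows that every thick
  subcategory containing \<open>X\<close> contains \<open>R\<close>.
\<close>

section \<open>Linear categories\<close>

context linear_category
begin

lemma zero_in_Hom: "0 \<in> Hom T X Y"
  by (rule subspace_0[OF subspace_Hom])

lemma add_in_Hom: "f \<in> Hom T X Y \<Longrightarrow> g \<in> Hom T X Y \<Longrightarrow> f + g \<in> Hom T X Y"
  by (rule subspace_add[OF subspace_Hom])

lemma diff_in_Hom: "f \<in> Hom T X Y \<Longrightarrow> g \<in> Hom T X Y \<Longrightarrow> f - g \<in> Hom T X Y"
  by (rule subspace_diff[OF subspace_Hom])

lemma uminus_in_Hom: "f \<in> Hom T X Y \<Longrightarrow> - f \<in> Hom T X Y"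
  by (rule subspace_neg[OF subspace_Hom])

lemma sum_in_Hom: "(\<And>a. a \<in> A \<Longrightarrow> f a \<in> Hom T X Y) \<Longrightarrow> sum f A \<in> Hom T X Y"
  by (rule subspace_sum[OF subspace_Hom])

lemma Comp_zero_right: "g \<in> Hom T Y Z \<Longrightarrow> g \<bullet> 0 = 0"
  using Comp_add_right[OF zero_in_Hom zero_in_Hom, of g Y Z] by simp

lemma Comp_zero_left: "f \<in> Hom T X Y \<Longrightarrow> 0 \<bullet> f = 0"
  using Comp_add_left[OF _ zero_in_Hom zero_in_Hom, of f X Y] by simp

lemma Comp_diff_right:
  assumes "f \<in> Hom T X Y" "f' \<in> Hom T X Y" "g \<in> Hom T Y Z"
  shows "g \<bullet> (f - f') = g \<bullet> f - g \<bullet> f'"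
  using Comp_add_right[OF diff_in_Hom[OF assms(1,2)] assms(2,3)] by (simp add: algebra_simps)

lemma Comp_diff_left:
  assumes "f \<in> Hom T X Y" "g \<in> Hom T Y Z" "g' \<in> Hom T Y Z"
  shows "(g - g') \<bullet> f = g \<bullet> f - g' \<bullet> f"
  using Comp_add_left[OF assms(1) diff_in_Hom[OF assms(2,3)] assms(3)] by (simp add: algebra_simps)

lemma Comp_uminus_right:
  assumes "f \<in> Hom T X Y" "g \<in> Hom T Y Z"
  shows "g \<bullet> (- f) = - (g \<bullet> f)"
  using Comp_diff_right[OF zero_in_Hom assms] Comp_zero_right[OF assms(2)] by simp

lemma Comp_uminus_left:
  assumes "f \<in> Hom T X Y" "g \<in> Hom T Y Z"
  shows "(- g) \<bullet> f = - (g \<bullet> f)"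
  using Comp_diff_left[OF assms(1) zero_in_Hom assms(2)] Comp_zero_left[OF assms(1)] by simp

lemma Comp_sum_right:
  assumes "\<And>a. a \<in> A \<Longrightarrow> f a \<in> Hom T X Y" and g: "g \<in> Hom T Y Z"
  shows "g \<bullet> sum f A = (\<Sum>a\<in>A. g \<bullet> f a)"
  using assms(1)
proof (induction A rule: infinite_finite_induct)
  case (insert x F)
  then show ?case using Comp_add_right[OF _ sum_in_Hom[of F f X Y] g, of "f x"] by simp
qed (auto simp: Comp_zero_right[OF g])

lemma Comp_sum_left:
  assumes "\<And>a. a \<in> A \<Longrightarrow> g a \<in> Hom T Y Z" and f: "f \<in> Hom T X Y"
  shows "sum g A \<bullet> f = (\<Sum>a\<in>A. g a \<bullet> f)"
  using assms(1)
proof (induction A rule: infinite_finite_induct)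
  case (insert x F)
  then show ?case using Comp_add_left[OF f _ sum_in_Hom[of F g Y Z], of "g x"] by simp
qed (auto simp: Comp_zero_left[OF f])

lemma Hom_zeroI: "(\<And>f. f \<in> Hom T X Y \<Longrightarrow> f = 0) \<Longrightarrow> Hom T X Y = {0}"
  using zero_in_Hom by blast

lemma zero_objectI:
  assumes "Ident T Z = 0" shows "zero_object T Z"
  unfolding zero_object_def
proof (intro allI conjI Hom_zeroI)
  fix X f
  show "f = 0" if "f \<in> Hom T X Z"
    using Comp_Ident_left[OF that] Comp_zero_left[OF that] assms by simp
  show "f = 0" if "f \<in> Hom T Z X"
    using Comp_Ident_right[OF that] Comp_zero_right[OF that] assms by simp
qed

section \<open>Direct sums and retracts\<close>

lemma direct_sumE:
  assumes "is_direct_sum T P Xs"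
  obtains \<iota> \<pi> where "\<And>a. a < length Xs \<Longrightarrow> \<iota> a \<in> Hom T (Xs ! a) P"
    and "\<And>a. a < length Xs \<Longrightarrow> \<pi> a \<in> Hom T P (Xs ! a)"
    and "\<And>a b. a < length Xs \<Longrightarrow> b < length Xs \<Longrightarrow>
           \<pi> a \<bullet> \<iota> b = (if a = b then Ident T (Xs ! a) else 0)"
    and "(\<Sum>a<length Xs. \<iota> a \<bullet> \<pi> a) = Ident T P"
  using assms unfolding is_direct_sum_def by blast

lemma biproductI:
  assumes "i \<in> Hom T A P" "j \<in> Hom T B P" "p \<in> Hom T P A" "q \<in> Hom T P B"
    and "p \<bullet> i = Ident T A" "q \<bullet> j = Ident T B" "p \<bullet> j = 0" "q \<bullet> i = 0"
    and "i \<bullet> p + j \<bullet> q = Ident T P"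
  shows "is_direct_sum T P [A, B]"
  unfolding is_direct_sum_def
  by (rule exI[of _ "\<lambda>a. if a = 0 then i else j"], rule exI[of _ "\<lambda>a. if a = 0 then p else q"])
     (use assms in \<open>auto simp: less_Suc_eq lessThan_Suc add.commute\<close>)

lemma biproductE:
  assumes "is_direct_sum T P [A, B]"
  obtains i j p q where
    "i \<in> Hom T A P" "j \<in> Hom T B P" "p \<in> Hom T P A" "q \<in> Hom T P B"
    "p \<bullet> i = Ident T A" "q \<bullet> j = Ident T B" "p \<bullet> j = 0" "q \<bullet> i = 0"
    "i \<bullet> p + j \<bullet> q = Ident T P"
proof (rule direct_sumE[OF assms])
  fix \<iota> \<pi>
  assume h: "\<And>a. a < length [A, B] \<Longrightarrow> \<iota> a \<in> Hom T ([A, B] ! a) P"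
    "\<And>a. a < length [A, B] \<Longrightarrow> \<pi> a \<in> Hom T P ([A, B] ! a)"
    "\<And>a b. a < length [A, B] \<Longrightarrow> b < length [A, B] \<Longrightarrow>
           \<pi> a \<bullet> \<iota> b = (if a = b then Ident T ([A, B] ! a) else 0)"
    "(\<Sum>a<length [A, B]. \<iota> a \<bullet> \<pi> a) = Ident T P"
  show thesis
    by (rule that[of "\<iota> 0" "\<iota> 1" "\<pi> 0" "\<pi> 1"])
       (use h(1,2)[of 0] h(1,2)[of 1] h(3)[of 0 0] h(3)[of 0 1] h(3)[of 1 0] h(3)[of 1 1] h(4)
        in \<open>simp_all add: lessThan_Suc add.commute\<close>)
qed

text \<open>
  Unlike \<open>direct_summand\<close>, this asks for no complement, which makes it transitive without any
  work. In a triangulated category the two notions agree (\<open>direct_summand_iff_retract\<close>).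
\<close>

definition retract :: "'o \<Rightarrow> 'o \<Rightarrow> bool" where
  "retract N M \<longleftrightarrow> (\<exists>q\<in>Hom T N M. \<exists>p\<in>Hom T M N. p \<bullet> q = Ident T N)"

lemma retract_refl: "retract X X"
  unfolding retract_def using Ident_in_Hom Comp_Ident_left by blast

lemma retract_trans:
  assumes "retract A B" "retract B C" shows "retract A C"
proof -
  obtain q p where 1: "q \<in> Hom T A B" "p \<in> Hom T B A" "p \<bullet> q = Ident T A"
    using assms(1) unfolding retract_def by blast
  obtain q' p' where 2: "q' \<in> Hom T B C" "p' \<in> Hom T C B" "p' \<bullet> q' = Ident T B"
    using assms(2) unfolding retract_def by blast
  have "(p \<bullet> p') \<bullet> (q' \<bullet> q) = p \<bullet> (p' \<bullet> (q' \<bullet> q))"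
    by (rule Comp_assoc[OF Comp_in_Hom[OF 1(1) 2(1)] 2(2) 1(2)])
  also have "p' \<bullet> (q' \<bullet> q) = q"
    using Comp_assoc[OF 1(1) 2(1,2)] 2(3) Comp_Ident_left[OF 1(1)] by simp
  finally show ?thesis
    unfolding retract_def using 1 2 Comp_in_Hom by metis
qed

lemma direct_summand_retract:
  assumes "direct_summand T N M" shows "retract N M"
  using assms unfolding direct_summand_def retract_def by (meson biproductE)

lemma Hom_retract_source:
  assumes "retract N M" "Hom T M W = {0}" shows "Hom T N W = {0}"
proof (rule Hom_zeroI)
  fix f assume f: "f \<in> Hom T N W"
  obtain q p where 1: "q \<in> Hom T N M" "p \<in> Hom T M N" "p \<bullet> q = Ident T N"
    using assms(1) unfolding retract_def by blast
  have "f \<bullet> p = 0" using Comp_in_Hom[OF 1(2) f] assms(2) by simp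
  then show "f = 0"
    using Comp_assoc[OF 1(1,2) f] 1(3) Comp_Ident_right[OF f] Comp_zero_left[OF 1(1)] by simp
qed

lemma Hom_retract_target:
  assumes "retract N M" "Hom T W M = {0}" shows "Hom T W N = {0}"
proof (rule Hom_zeroI)
  fix f assume f: "f \<in> Hom T W N"
  obtain q p where 1: "q \<in> Hom T N M" "p \<in> Hom T M N" "p \<bullet> q = Ident T N"
    using assms(1) unfolding retract_def by blast
  have "q \<bullet> f = 0" using Comp_in_Hom[OF f 1(1)] assms(2) by simp
  then show "f = 0"
    using Comp_assoc[OF f 1(1,2)] 1(3) Comp_Ident_left[OF f] Comp_zero_right[OF 1(2)] by simp
qed

lemma Hom_direct_sum_source:
  assumes "is_direct_sum T P Xs" "\<And>N. N \<in> set Xs \<Longrightarrow> Hom T N W = {0}"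
  shows "Hom T P W = {0}"
proof (rule Hom_zeroI)
  fix f assume f: "f \<in> Hom T P W"
  obtain \<iota> \<pi> where s: "\<And>a. a < length Xs \<Longrightarrow> \<iota> a \<in> Hom T (Xs ! a) P"
    "\<And>a. a < length Xs \<Longrightarrow> \<pi> a \<in> Hom T P (Xs ! a)"
    "\<And>a b. a < length Xs \<Longrightarrow> b < length Xs \<Longrightarrow>
        \<pi> a \<bullet> \<iota> b = (if a = b then Ident T (Xs ! a) else 0)"
    "(\<Sum>a<length Xs. \<iota> a \<bullet> \<pi> a) = Ident T P"
    by (rule direct_sumE[OF assms(1)]) blast
  have "f = f \<bullet> (\<Sum>a<length Xs. \<iota> a \<bullet> \<pi> a)" using s(4) Comp_Ident_right[OF f] by simp
  also have "\<dots> = (\<Sum>a<length Xs. f \<bullet> (\<iota> a \<bullet> \<pi> a))"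
    by (rule Comp_sum_right[OF _ f]) (use Comp_in_Hom[OF s(2,1)] in auto)
  also have "\<dots> = 0"
  proof (intro sum.neutral ballI)
    fix a assume "a \<in> {..<length Xs}"
    then have a: "a < length Xs" by simp
    have "f \<bullet> \<iota> a = 0" using Comp_in_Hom[OF s(1)[OF a] f] assms(2)[of "Xs ! a"] a by simp
    then show "f \<bullet> (\<iota> a \<bullet> \<pi> a) = 0"
      using Comp_assoc[OF s(2)[OF a] s(1)[OF a] f] Comp_zero_left[OF s(2)[OF a]] by simp
  qed
  finally show "f = 0" .
qed

lemma Hom_direct_sum_target:
  assumes "is_direct_sum T P Xs" "\<And>N. N \<in> set Xs \<Longrightarrow> Hom T W N = {0}"
  shows "Hom T W P = {0}"
proof (rule Hom_zeroI)
  fix f assume f: "f \<in> Hom T W P"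
  obtain \<iota> \<pi> where s: "\<And>a. a < length Xs \<Longrightarrow> \<iota> a \<in> Hom T (Xs ! a) P"
    "\<And>a. a < length Xs \<Longrightarrow> \<pi> a \<in> Hom T P (Xs ! a)"
    "\<And>a b. a < length Xs \<Longrightarrow> b < length Xs \<Longrightarrow>
        \<pi> a \<bullet> \<iota> b = (if a = b then Ident T (Xs ! a) else 0)"
    "(\<Sum>a<length Xs. \<iota> a \<bullet> \<pi> a) = Ident T P"
    by (rule direct_sumE[OF assms(1)]) blast
  have "f = (\<Sum>a<length Xs. \<iota> a \<bullet> \<pi> a) \<bullet> f" using s(4) Comp_Ident_left[OF f] by simp
  also have "\<dots> = (\<Sum>a<length Xs. (\<iota> a \<bullet> \<pi> a) \<bullet> f)"
    by (rule Comp_sum_left[OF _ f]) (use Comp_in_Hom[OF s(2,1)] in auto)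
  also have "\<dots> = 0"
  proof (intro sum.neutral ballI)
    fix a assume "a \<in> {..<length Xs}"
    then have a: "a < length Xs" by simp
    have "\<pi> a \<bullet> f = 0" using Comp_in_Hom[OF f s(2)[OF a]] assms(2)[of "Xs ! a"] a by simp
    then show "(\<iota> a \<bullet> \<pi> a) \<bullet> f = 0"
      using Comp_assoc[OF f s(2)[OF a] s(1)[OF a]] Comp_zero_right[OF s(1)[OF a]] by simp
  qed
  finally show "f = 0" .
qed

lemma Hom_add_source: "P \<in> add T M \<Longrightarrow> Hom T M W = {0} \<Longrightarrow> Hom T P W = {0}"
  unfolding add_def using Hom_direct_sum_source Hom_retract_source direct_summand_retract by blast

lemma Hom_add_target: "P \<in> add T M \<Longrightarrow> Hom T W M = {0} \<Longrightarrow> Hom T W P = {0}"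
  unfolding add_def using Hom_direct_sum_target Hom_retract_target direct_summand_retract by blast

text \<open>
  Direct sums of lists can be built up one summand at a time. This reduces closure under finite
  direct sums to closure under binary ones.
\<close>

lemma direct_sum_Cons:
  assumes P: "is_direct_sum T P (x # xs)" and Q: "is_direct_sum T Q xs"
  shows "is_direct_sum T P [x, Q]"
proof -
  let ?n = "length xs"
  obtain \<iota> \<pi> where "\<And>a. a < length (x # xs) \<Longrightarrow> \<iota> a \<in> Hom T ((x # xs) ! a) P"
    "\<And>a. a < length (x # xs) \<Longrightarrow> \<pi> a \<in> Hom T P ((x # xs) ! a)"
    "\<And>a b. a < length (x # xs) \<Longrightarrow> b < length (x # xs) \<Longrightarrow>
        \<pi> a \<bullet> \<iota> b = (if a = b then Ident T ((x # xs) ! a) else 0)"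
    "(\<Sum>a<length (x # xs). \<iota> a \<bullet> \<pi> a) = Ident T P"
    by (rule direct_sumE[OF P]) blast
  note s = this
  obtain \<iota>' \<pi>' where t: "\<And>a. a < ?n \<Longrightarrow> \<iota>' a \<in> Hom T (xs ! a) Q"
    "\<And>a. a < ?n \<Longrightarrow> \<pi>' a \<in> Hom T Q (xs ! a)"
    "\<And>a b. a < ?n \<Longrightarrow> b < ?n \<Longrightarrow> \<pi>' a \<bullet> \<iota>' b = (if a = b then Ident T (xs ! a) else 0)"
    "(\<Sum>a<?n. \<iota>' a \<bullet> \<pi>' a) = Ident T Q"
    by (rule direct_sumE[OF Q]) blast
  have i: "\<iota> 0 \<in> Hom T x P" "\<pi> 0 \<in> Hom T P x" "\<pi> 0 \<bullet> \<iota> 0 = Ident T x"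
    using s(1-2)[of 0] s(3)[of 0 0] by auto
  have I: "\<iota> (Suc a) \<in> Hom T (xs ! a) P" "\<pi> (Suc a) \<in> Hom T P (xs ! a)" if "a < ?n" for a
    using s(1-2)[of "Suc a"] that by auto
  have O: "\<pi> (Suc a) \<bullet> \<iota> (Suc b) = (if a = b then Ident T (xs ! a) else 0)"
    "\<pi> 0 \<bullet> \<iota> (Suc a) = 0" "\<pi> (Suc a) \<bullet> \<iota> 0 = 0" if "a < ?n" "b < ?n" for a b
    using s(3)[of "Suc a" "Suc b"] s(3)[of 0 "Suc a"] s(3)[of "Suc a" 0] that by auto
  define j where "j = (\<Sum>a<?n. \<iota> (Suc a) \<bullet> \<pi>' a)"
  define q where "q = (\<Sum>a<?n. \<iota>' a \<bullet> \<pi> (Suc a))"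
  have jm: "\<iota> (Suc a) \<bullet> \<pi>' a \<in> Hom T Q P" if "a < ?n" for a
    using Comp_in_Hom[OF t(2) I(1)] that by blast
  have qm: "\<iota>' a \<bullet> \<pi> (Suc a) \<in> Hom T P Q" if "a < ?n" for a
    using Comp_in_Hom[OF I(2) t(1)] that by blast
  have j: "j \<in> Hom T Q P" and q: "q \<in> Hom T P Q"
    unfolding j_def q_def using jm qm by (auto intro!: sum_in_Hom)
  have c1: "\<pi> (Suc b) \<bullet> (\<iota> (Suc a) \<bullet> \<pi>' a) = (if a = b then \<pi>' a else 0)"
    if "a < ?n" "b < ?n" for a b
    using Comp_assoc[OF t(2)[OF that(1)] I(1)[OF that(1)] I(2)[OF that(2)]] O(1)[OF that(2,1)]
      Comp_Ident_left[OF t(2)[OF that(1)]] Comp_zero_left[OF t(2)[OF that(1)]] by auto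
  have c2: "\<pi> (Suc b) \<bullet> j = \<pi>' b" if "b < ?n" for b
    unfolding j_def using that jm c1
    by (subst Comp_sum_right[OF _ I(2)[OF that]]) (auto simp: sum.delta)
  have qk: "q \<bullet> k = (\<Sum>b<?n. \<iota>' b \<bullet> (\<pi> (Suc b) \<bullet> k))" if "k \<in> Hom T Y P" for k Y
    unfolding q_def
    by (subst Comp_sum_left[OF _ that]) (use qm Comp_assoc[OF that I(2) t(1)] in auto)
  have kj: "k \<bullet> j = (\<Sum>b<?n. (k \<bullet> \<iota> (Suc b)) \<bullet> \<pi>' b)" if "k \<in> Hom T P Y" for k Y
    unfolding j_def
    by (subst Comp_sum_right[OF _ that]) (use jm Comp_assoc[OF t(2) I(1) that] in auto)
  have qj: "q \<bullet> j = Ident T Q"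
    unfolding qk[OF j] t(4)[symmetric] by (rule sum.cong) (auto simp: c2)
  have "q \<bullet> \<iota> 0 = 0"
    unfolding qk[OF i(1)] by (rule sum.neutral) (auto simp: O(3) Comp_zero_right[OF t(1)])
  moreover have "\<pi> 0 \<bullet> j = 0"
    unfolding kj[OF i(2)] by (rule sum.neutral) (auto simp: O(2) Comp_zero_left[OF t(2)])
  moreover have "j \<bullet> q = (\<Sum>a<?n. \<iota> (Suc a) \<bullet> \<pi> (Suc a))"
  proof -
    have pq: "\<pi>' a \<bullet> q = \<pi> (Suc a)" if a: "a < ?n" for a
    proof -
      have "\<pi>' a \<bullet> (\<iota>' b \<bullet> \<pi> (Suc b)) = (if a = b then \<pi> (Suc b) else 0)" if b: "b < ?n" for b
        using Comp_assoc[OF I(2)[OF b] t(1)[OF b] t(2)[OF a]] t(3)[OF a b]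
          Comp_Ident_left[OF I(2)[OF b]] Comp_zero_left[OF I(2)[OF b]] by auto
      then show ?thesis
        unfolding q_def using a qm by (subst Comp_sum_right[OF _ t(2)[OF a]]) (auto simp: sum.delta)
    qed
    have "j \<bullet> q = (\<Sum>a<?n. (\<iota> (Suc a) \<bullet> \<pi>' a) \<bullet> q)"
      unfolding j_def by (rule Comp_sum_left[OF _ q]) (use jm in auto)
    also have "\<dots> = (\<Sum>a<?n. \<iota> (Suc a) \<bullet> \<pi> (Suc a))"
      by (rule sum.cong) (use Comp_assoc[OF q t(2) I(1)] pq in auto)
    finally show ?thesis .
  qed
  then have "\<iota> 0 \<bullet> \<pi> 0 + j \<bullet> q = Ident T P"
    using s(4) by (simp add: sum.lessThan_Suc_shift del: sum.lessThan_Suc)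
  ultimately show ?thesis using biproductI[OF i(1) j i(2) q i(3) qj] by simp
qed

section \<open>Local endomorphism rings\<close>

lemma zero_not_iso: "Ident T Y \<noteq> 0 \<Longrightarrow> \<not> is_iso T Y Y 0"
  unfolding is_iso_def using Comp_zero_right by metis

lemma local_End_sum:
  fixes n :: nat
  assumes "local_End T Y" "\<And>a. a < n \<Longrightarrow> e a \<in> Hom T Y Y"
    "\<And>a. a < n \<Longrightarrow> \<not> is_iso T Y Y (e a)"
  shows "\<not> is_iso T Y Y (\<Sum>a<n. e a)"
  using assms(2,3)
proof (induction n)
  case 0
  then show ?case using zero_not_iso assms(1) unfolding local_End_def by simp
next
  case (Suc n)
  have "(\<Sum>a<n. e a) \<in> Hom T Y Y" by (rule sum_in_Hom) (use Suc in auto)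
  then show ?case using Suc assms(1) unfolding local_End_def by simp
qed

lemma is_iso_Ident: "is_iso T Y Y (Ident T Y)"
  unfolding is_iso_def using Ident_in_Hom Comp_Ident_left by blast

text \<open>
  The identity of \<open>Y\<close> is a sum of endomorphisms, each factoring through one of the summands. Since
  \<open>Y\<close> has a local endomorphism ring, one of them is invertible, and \<open>Y\<close> is a retract of the
  corresponding summand.
\<close>

lemma local_retract_direct_sum:
  assumes Y: "local_End T Y" and P: "is_direct_sum T P Xs" and r: "retract Y P"
  shows "\<exists>N\<in>set Xs. retract Y N"
proof -
  obtain q p where 1: "q \<in> Hom T Y P" "p \<in> Hom T P Y" "p \<bullet> q = Ident T Y"
    using r unfolding retract_def by blast
  obtain \<iota> \<pi> where s: "\<And>a. a < length Xs \<Longrightarrow> \<iota> a \<in> Hom T (Xs ! a) P"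
    "\<And>a. a < length Xs \<Longrightarrow> \<pi> a \<in> Hom T P (Xs ! a)"
    "\<And>a b. a < length Xs \<Longrightarrow> b < length Xs \<Longrightarrow>
        \<pi> a \<bullet> \<iota> b = (if a = b then Ident T (Xs ! a) else 0)"
    "(\<Sum>a<length Xs. \<iota> a \<bullet> \<pi> a) = Ident T P"
    by (rule direct_sumE[OF P]) blast
  let ?e = "\<lambda>a. (p \<bullet> \<iota> a) \<bullet> (\<pi> a \<bullet> q)"
  have A: "p \<bullet> \<iota> a \<in> Hom T (Xs ! a) Y" "\<pi> a \<bullet> q \<in> Hom T Y (Xs ! a)" if "a < length Xs" for a
    using Comp_in_Hom[OF s(1)[OF that] 1(2)] Comp_in_Hom[OF 1(1) s(2)[OF that]] by auto
  have "Ident T Y = p \<bullet> ((\<Sum>a<length Xs. \<iota> a \<bullet> \<pi> a) \<bullet> q)"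
    unfolding s(4) Comp_Ident_left[OF 1(1)] 1(3) ..
  also have "(\<Sum>a<length Xs. \<iota> a \<bullet> \<pi> a) \<bullet> q = (\<Sum>a<length Xs. \<iota> a \<bullet> (\<pi> a \<bullet> q))"
    by (subst Comp_sum_left[OF _ 1(1)]) (use Comp_in_Hom[OF s(2,1)] Comp_assoc[OF 1(1) s(2,1)] in auto)
  also have "p \<bullet> \<dots> = (\<Sum>a<length Xs. p \<bullet> (\<iota> a \<bullet> (\<pi> a \<bullet> q)))"
    by (rule Comp_sum_right[OF _ 1(2)]) (use Comp_in_Hom[OF A(2) s(1)] in auto)
  also have "\<dots> = (\<Sum>a<length Xs. ?e a)"
    by (rule sum.cong) (use Comp_assoc[OF A(2) s(1) 1(2)] in auto)
  finally have "is_iso T Y Y (\<Sum>a<length Xs. ?e a)" using is_iso_Ident by metis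
  then obtain a where a: "a < length Xs" "is_iso T Y Y (?e a)"
    using local_End_sum[OF Y, of "length Xs" ?e] A Comp_in_Hom by blast
  then obtain v where v: "v \<in> Hom T Y Y" "v \<bullet> ?e a = Ident T Y"
    unfolding is_iso_def by blast
  have "(v \<bullet> (p \<bullet> \<iota> a)) \<bullet> (\<pi> a \<bullet> q) = Ident T Y"
    using Comp_assoc[OF A(2)[OF a(1)] A(1)[OF a(1)] v(1)] v(2) by simp
  then have "retract Y (Xs ! a)"
    unfolding retract_def using A[OF a(1)] Comp_in_Hom[OF A(1)[OF a(1)] v(1)] by blast
  then show ?thesis using a(1) by auto
qed

lemma retract_of_direct_sum:
  assumes P: "is_direct_sum T P Xs" and N: "N \<in> set Xs" shows "retract N P"
proof -
  obtain \<iota> \<pi> where s: "\<And>a. a < length Xs \<Longrightarrow> \<iota> a \<in> Hom T (Xs ! a) P"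
    "\<And>a. a < length Xs \<Longrightarrow> \<pi> a \<in> Hom T P (Xs ! a)"
    "\<And>a b. a < length Xs \<Longrightarrow> b < length Xs \<Longrightarrow>
        \<pi> a \<bullet> \<iota> b = (if a = b then Ident T (Xs ! a) else 0)"
    "(\<Sum>a<length Xs. \<iota> a \<bullet> \<pi> a) = Ident T P"
    by (rule direct_sumE[OF P]) blast
  obtain a where "a < length Xs" "N = Xs ! a" using N by (metis in_set_conv_nth)
  then show ?thesis unfolding retract_def using s by (metis (full_types))
qed

section \<open>Right approximations\<close>

text \<open>
  A finite spanning set of \<open>Hom(X, W)\<close>, listed as \<open>bs\<close>, assembles into a single map from a power of
  \<open>X\<close> to \<open>W\<close> through which all its members factor. The maps factoring through it form a subspace,
  so all of \<open>Hom(X, W)\<close> factors.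
\<close>

lemma approximation:
  assumes fin: "Hom_finite T" and sums: "\<And>Xs. \<exists>P. is_direct_sum T P Xs"
  obtains P n p where "is_direct_sum T P (replicate n X)" "p \<in> Hom T P W"
    "\<And>f. f \<in> Hom T X W \<Longrightarrow> \<exists>u\<in>Hom T X P. f = p \<bullet> u"
proof -
  obtain B where B: "finite B" "span B = Hom T X W"
    using fin unfolding Hom_finite_def by blast
  obtain bs where bs: "set bs = B" using finite_list[OF B(1)] by blast
  have bm: "bs ! a \<in> Hom T X W" if "a < length bs" for a
    using that bs B(2) span_superset by (metis nth_mem subsetD)
  let ?n = "length bs"
  obtain P where P: "is_direct_sum T P (replicate ?n X)" using sums by blast
  have "\<exists>\<iota> \<pi>. (\<forall>a<?n. \<iota> a \<in> Hom T X P) \<and> (\<forall>a<?n. \<pi> a \<in> Hom T P X)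
      \<and> (\<forall>a<?n. \<forall>b<?n. \<pi> a \<bullet> \<iota> b = (if a = b then Ident T X else 0))"
    by (rule direct_sumE[OF P]) (metis (no_types, lifting) length_replicate nth_replicate)
  then obtain \<iota> \<pi> where s: "\<And>a. a < ?n \<Longrightarrow> \<iota> a \<in> Hom T X P" "\<And>a. a < ?n \<Longrightarrow> \<pi> a \<in> Hom T P X"
    "\<And>a b. a < ?n \<Longrightarrow> b < ?n \<Longrightarrow> \<pi> a \<bullet> \<iota> b = (if a = b then Ident T X else 0)"
    by blast
  define p where "p = (\<Sum>a<?n. bs ! a \<bullet> \<pi> a)"
  have pm: "bs ! a \<bullet> \<pi> a \<in> Hom T P W" if "a < ?n" for a
    using Comp_in_Hom[OF s(2) bm] that by blast
  have p: "p \<in> Hom T P W" unfolding p_def by (rule sum_in_Hom) (use pm in auto)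
  have pi: "p \<bullet> \<iota> b = bs ! b" if b: "b < ?n" for b
  proof -
    have "(bs ! a \<bullet> \<pi> a) \<bullet> \<iota> b = (if a = b then bs ! a else 0)" if a: "a < ?n" for a
      using Comp_assoc[OF s(1)[OF b] s(2)[OF a] bm[OF a]] s(3)[OF a b]
        Comp_Ident_right[OF bm[OF a]] Comp_zero_right[OF bm[OF a]] by auto
    then show ?thesis
      unfolding p_def using b pm by (subst Comp_sum_left[OF _ s(1)[OF b]]) (auto simp: sum.delta)
  qed
  have "subspace {p \<bullet> u | u. u \<in> Hom T X P}"
    unfolding subspace_def
  proof (intro conjI ballI allI)
    show "0 \<in> {p \<bullet> u | u. u \<in> Hom T X P}"
      using Comp_zero_right[OF p] zero_in_Hom by (metis (mono_tags, lifting) mem_Collect_eq)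
  next
    fix x y assume "x \<in> {p \<bullet> u | u. u \<in> Hom T X P}" "y \<in> {p \<bullet> u | u. u \<in> Hom T X P}"
    then show "x + y \<in> {p \<bullet> u | u. u \<in> Hom T X P}"
      using Comp_add_right[OF _ _ p] add_in_Hom by (smt (verit) mem_Collect_eq)
  next
    fix c x assume "x \<in> {p \<bullet> u | u. u \<in> Hom T X P}"
    then show "Scale T c x \<in> {p \<bullet> u | u. u \<in> Hom T X P}"
      using Comp_Scale_right[OF _ p] subspace_scale[OF subspace_Hom]
      by (smt (verit) mem_Collect_eq)
  qed
  moreover have "B \<subseteq> {p \<bullet> u | u. u \<in> Hom T X P}"
  proof
    fix b assume "b \<in> B"
    then obtain a where a: "a < ?n" "b = bs ! a" using bs by (metis in_set_conv_nth)
    then have "b = p \<bullet> \<iota> a" using pi by simp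
    then show "b \<in> {p \<bullet> u | u. u \<in> Hom T X P}" using s(1)[OF a(1)] by blast
  qed
  ultimately have "Hom T X W \<subseteq> {p \<bullet> u | u. u \<in> Hom T X P}"
    using span_minimal[of B] B(2) by simp
  then show thesis by (intro that[OF P p]) blast
qed

end


section \<open>Triangles\<close>

definition exact_triangle :: "('k, 'o, 'm, 'z) tri_cat_scheme \<Rightarrow> 'o \<Rightarrow> 'o \<Rightarrow> 'o \<Rightarrow> bool" where
  "exact_triangle T X Y Z \<longleftrightarrow> (\<exists>f g h. Tri T X Y Z f g h)"

context triangulated_category
begin

abbreviation shift_iter :: "nat \<Rightarrow> 'o \<Rightarrow> 'o" where
  "shift_iter i X \<equiv> (Shift T ^^ i) X"

lemma ShiftM_in_Hom: "f \<in> Hom T X Y \<Longrightarrow> ShiftM T f \<in> Hom T (Shift T X) (Shift T Y)"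
  using ShiftM_bij by (metis bij_betw_imp_surj_on imageI)

lemma ShiftM_surj:
  assumes "g \<in> Hom T (Shift T X) (Shift T Y)"
  obtains f where "f \<in> Hom T X Y" "g = ShiftM T f"
  using assms ShiftM_bij[of X Y] by (metis bij_betw_imp_surj_on imageE)

lemma ShiftM_inj:
  "f \<in> Hom T X Y \<Longrightarrow> g \<in> Hom T X Y \<Longrightarrow> ShiftM T f = ShiftM T g \<Longrightarrow> f = g"
  using ShiftM_bij[of X Y] by (metis bij_betw_imp_inj_on inj_onD)

lemma ShiftM_zero: "ShiftM T 0 = 0"
  using ShiftM_add[OF zero_in_Hom zero_in_Hom] by simp

lemma ShiftM_uminus: "f \<in> Hom T X Y \<Longrightarrow> ShiftM T (- f) = - ShiftM T f"
  using ShiftM_add[OF _ uminus_in_Hom, of f X Y f] ShiftM_zero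
  by (simp add: eq_neg_iff_add_eq_0 add.commute)

lemma ShiftM_sum:
  assumes "\<And>a. a \<in> A \<Longrightarrow> f a \<in> Hom T X Y"
  shows "ShiftM T (sum f A) = (\<Sum>a\<in>A. ShiftM T (f a))"
  using assms
proof (induction A rule: infinite_finite_induct)
  case (insert x F)
  then show ?case using ShiftM_add[OF _ sum_in_Hom[of F f X Y], of "f x"] by simp
qed (auto simp: ShiftM_zero)

lemma Hom_Shift_zero_iff: "Hom T (Shift T X) (Shift T Y) = {0} \<longleftrightarrow> Hom T X Y = {0}"
proof
  assume "Hom T (Shift T X) (Shift T Y) = {0}"
  then show "Hom T X Y = {0}"
    using ShiftM_in_Hom ShiftM_inj[OF _ zero_in_Hom] ShiftM_zero
    by (intro Hom_zeroI) (metis singletonD)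
next
  assume "Hom T X Y = {0}"
  then show "Hom T (Shift T X) (Shift T Y) = {0}"
    using ShiftM_zero by (intro Hom_zeroI) (metis ShiftM_surj singletonD)
qed

lemma zero_object_Shift: "zero_object T Z \<Longrightarrow> zero_object T (Shift T Z)"
  using Ident_in_Hom[of Z] ShiftM_Ident[of Z] ShiftM_zero
  by (intro zero_objectI) (auto simp: zero_object_def)

lemma obtain_zero_object: obtains Z where "zero_object T Z"
proof -
  obtain P where "is_direct_sum T P []" using direct_sums by blast
  then have "Ident T P = 0" unfolding is_direct_sum_def by simp
  then show thesis using that zero_objectI by blast
qed

lemma Tri_rotate: "Tri T X Y Z f g h \<Longrightarrow> Tri T Y Z (Shift T X) g h (- ShiftM T f)"
  using TR2 Tri_in_Hom by blast

lemma Tri_comp_zero: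
  assumes "Tri T X Y Z f g h" shows "g \<bullet> f = 0"
proof -
  have H: "f \<in> Hom T X Y" "g \<in> Hom T Y Z" using Tri_in_Hom[OF assms] by auto
  obtain N where N: "zero_object T N" by (rule obtain_zero_object)
  obtain w where w: "w \<in> Hom T N Z" "w \<bullet> 0 = g \<bullet> f"
    using TR3[OF TR1_Ident[OF N] assms Ident_in_Hom H(1)] by auto
  then show ?thesis using Comp_zero_right by metis
qed

lemma Tri_comp_zero':
  assumes "Tri T X Y Z f g h" shows "h \<bullet> g = 0" "ShiftM T f \<bullet> h = 0"
proof -
  show "h \<bullet> g = 0" by (rule Tri_comp_zero[OF Tri_rotate[OF assms]])
  have H: "f \<in> Hom T X Y" "h \<in> Hom T Z (Shift T X)" using Tri_in_Hom[OF assms] by auto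
  have "(- ShiftM T f) \<bullet> h = 0" by (rule Tri_comp_zero[OF Tri_rotate[OF Tri_rotate[OF assms]]])
  then show "ShiftM T f \<bullet> h = 0" using Comp_uminus_left[OF H(2) ShiftM_in_Hom[OF H(1)]] by simp
qed

text \<open>
  Since \<open>g v = 0\<close>, the map \<open>v\<close> is the first component of a map of triangles from
  \<open>W \<rightarrow> 0 \<rightarrow> W[1] \<rightarrow> W[1]\<close>, the rotation of the trivial triangle on \<open>W\<close>, to the rotation of the given
  one. Its third component is a shifted map \<open>u[1]\<close>, since the shift is full, and both triangles carry
  the same sign, so \<open>u\<close> is the required lift.
\<close>

lemma Hom_exact_covariant:
  assumes t: "Tri T X Y Z f g h" and v: "v \<in> Hom T W Y" "g \<bullet> v = 0"
  shows "\<exists>u\<in>Hom T W X. v = f \<bullet> u"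
proof -
  have H: "f \<in> Hom T X Y" "g \<in> Hom T Y Z" using Tri_in_Hom[OF t] by auto
  obtain N where N: "zero_object T N" by (rule obtain_zero_object)
  have 1: "Tri T W N (Shift T W) 0 0 (- Ident T (Shift T W))"
    using Tri_rotate[OF TR1_Ident[OF N]] ShiftM_Ident by simp
  have "0 \<bullet> 0 = g \<bullet> v" using v(2) Comp_zero_left[OF zero_in_Hom] by simp
  from TR3[OF 1 Tri_rotate[OF t] v(1) zero_in_Hom this]
  obtain w where w: "w \<in> Hom T (Shift T W) (Shift T X)"
    "ShiftM T v \<bullet> (- Ident T (Shift T W)) = (- ShiftM T f) \<bullet> w" by blast
  obtain u where u: "u \<in> Hom T W X" "w = ShiftM T u" by (rule ShiftM_surj[OF w(1)])
  have "ShiftM T v \<bullet> (- Ident T (Shift T W)) = - ShiftM T v"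
    using Comp_uminus_right[OF Ident_in_Hom ShiftM_in_Hom[OF v(1)]]
      Comp_Ident_right[OF ShiftM_in_Hom[OF v(1)]] by simp
  moreover have "(- ShiftM T f) \<bullet> w = - ShiftM T (f \<bullet> u)"
    using Comp_uminus_left[OF w(1) ShiftM_in_Hom[OF H(1)]] ShiftM_Comp[OF u(1) H(1)] u(2) by simp
  ultimately have "ShiftM T v = ShiftM T (f \<bullet> u)" using w(2) by simp
  then show ?thesis using ShiftM_inj[OF v(1) Comp_in_Hom[OF u(1) H(1)]] u(1) by blast
qed

text \<open>
  A map vanishing on \<open>X\<close> is the middle component of a map of triangles to \<open>0 \<rightarrow> W \<rightarrow> W \<rightarrow> 0\<close>.
\<close>

lemma Hom_exact_contravariant:
  assumes t: "Tri T X Y Z f g h" and v: "v \<in> Hom T Y W" "v \<bullet> f = 0"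
  shows "\<exists>w\<in>Hom T Z W. v = w \<bullet> g"
proof -
  obtain N where N: "zero_object T N" by (rule obtain_zero_object)
  have "Tri T W W (Shift T N) (Ident T W) 0 (- ShiftM T 0)"
    using TR1_Ident[OF zero_object_Shift[OF N]] ShiftM_zero by simp
  then have 1: "Tri T N W W 0 (Ident T W) 0"
    using TR2 zero_in_Hom Ident_in_Hom by blast
  have "v \<bullet> f = 0 \<bullet> 0" using v(2) Comp_zero_left[OF zero_in_Hom] by simp
  from TR3[OF t 1 zero_in_Hom v(1) this]
  obtain w where "w \<in> Hom T Z W" "w \<bullet> g = Ident T W \<bullet> v" by blast
  then show ?thesis using Comp_Ident_left[OF v(1)] by auto
qed

text \<open>
  The shift is full, so \<open>h\<close> is the shift of some map; its negative compensates the sign that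
  \<open>TR2\<close> introduces.
\<close>

lemma Tri_unrotate:
  assumes t: "Tri T A B (Shift T C) f g h" shows "\<exists>k. Tri T C A B k f g"
proof -
  have H: "f \<in> Hom T A B" "g \<in> Hom T B (Shift T C)" "h \<in> Hom T (Shift T C) (Shift T A)"
    using Tri_in_Hom[OF t] by auto
  obtain k where k: "k \<in> Hom T C A" "h = ShiftM T k" by (rule ShiftM_surj[OF H(3)])
  then have "h = - ShiftM T (- k)" using ShiftM_uminus by simp
  then have "Tri T C A B (- k) f g"
    using TR2[OF uminus_in_Hom[OF k(1)] H(1,2)] t by simp
  then show ?thesis by blast
qed

text \<open>
  The third object of a cone need only be isomorphic to a shifted object, so the triangle has to be
  transported along this isomorphism before it can be rotated back.
\<close>

lemma Tri_cocone:
  assumes f: "f \<in> Hom T B C" shows "\<exists>A a h. Tri T A B C a f h"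
proof -
  obtain V g h where V: "Tri T B C V f g h" using TR1_cone[OF f] by blast
  have H: "g \<in> Hom T C V" "h \<in> Hom T V (Shift T B)" using Tri_in_Hom[OF V] by auto
  obtain A \<theta> where "is_iso T (Shift T A) V \<theta>"
    using Shift_ess_surj[of V] unfolding isomorphic_def by blast
  then obtain \<phi> where \<theta>: "\<theta> \<in> Hom T (Shift T A) V" "\<phi> \<in> Hom T V (Shift T A)"
    "\<phi> \<bullet> \<theta> = Ident T (Shift T A)" "\<theta> \<bullet> \<phi> = Ident T V"
    unfolding is_iso_def by blast
  have g': "\<phi> \<bullet> g \<in> Hom T C (Shift T A)" and h': "h \<bullet> \<theta> \<in> Hom T (Shift T A) (Shift T B)"
    using Comp_in_Hom[OF H(1) \<theta>(2)] Comp_in_Hom[OF \<theta>(1) H(2)] by auto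
  have "Tri T B C (Shift T A) f (\<phi> \<bullet> g) (h \<bullet> \<theta>)"
  proof (rule TR1_iso[OF V is_iso_Ident is_iso_Ident _ f g' h'])
    show "is_iso T V (Shift T A) \<phi>" unfolding is_iso_def using \<theta> by blast
    show "Ident T C \<bullet> f = f \<bullet> Ident T B" using Comp_Ident_left[OF f] Comp_Ident_right[OF f] by simp
    show "\<phi> \<bullet> g = (\<phi> \<bullet> g) \<bullet> Ident T C" using Comp_Ident_right[OF g'] by simp
    show "ShiftM T (Ident T B) \<bullet> h = (h \<bullet> \<theta>) \<bullet> \<phi>"
      using ShiftM_Ident Comp_Ident_left[OF H(2)] Comp_assoc[OF \<theta>(2,1) H(2)] \<theta>(4)
        Comp_Ident_right[OF H(2)] by simp
  qed
  then show ?thesis using Tri_unrotate by blast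
qed

section \<open>Vanishing of Hom spaces along triangles\<close>

lemma exact_triangle_rotate: "exact_triangle T X Y Z \<Longrightarrow> exact_triangle T Y Z (Shift T X)"
  unfolding exact_triangle_def using Tri_rotate by blast

lemma exact_triangle_unrotate: "exact_triangle T A B (Shift T C) \<Longrightarrow> exact_triangle T C A B"
  unfolding exact_triangle_def using Tri_unrotate by blast

lemma exact_triangle_shift_iter:
  "exact_triangle T X Y Z \<Longrightarrow> exact_triangle T (shift_iter i X) (shift_iter i Y) (shift_iter i Z)"
  by (induction i) (auto dest: exact_triangle_rotate)

lemma Hom_zero_middle_target:
  assumes "exact_triangle T A B C" "Hom T W A = {0}" "Hom T W C = {0}"
  shows "Hom T W B = {0}"
proof (rule Hom_zeroI)
  fix v assume v: "v \<in> Hom T W B"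
  obtain f g h where t: "Tri T A B C f g h" using assms(1) unfolding exact_triangle_def by blast
  have H: "f \<in> Hom T A B" "g \<in> Hom T B C" using Tri_in_Hom[OF t] by auto
  have "g \<bullet> v = 0" using Comp_in_Hom[OF v H(2)] assms(3) by simp
  then obtain u where "u \<in> Hom T W A" "v = f \<bullet> u" using Hom_exact_covariant[OF t v] by blast
  then show "v = 0" using assms(2) Comp_zero_right[OF H(1)] by simp
qed

lemma Hom_zero_middle_source:
  assumes "exact_triangle T A B C" "Hom T A W = {0}" "Hom T C W = {0}"
  shows "Hom T B W = {0}"
proof (rule Hom_zeroI)
  fix v assume v: "v \<in> Hom T B W"
  obtain f g h where t: "Tri T A B C f g h" using assms(1) unfolding exact_triangle_def by blast
  have H: "f \<in> Hom T A B" "g \<in> Hom T B C" using Tri_in_Hom[OF t] by auto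
  have "v \<bullet> f = 0" using Comp_in_Hom[OF H(1) v] assms(2) by simp
  then obtain u where "u \<in> Hom T C W" "v = u \<bullet> g" using Hom_exact_contravariant[OF t v] by blast
  then show "v = 0" using assms(3) Comp_zero_left[OF H(2)] by simp
qed

section \<open>Splitting of retracts\<close>

text \<open>
  The complement of a retract \<open>N\<close> of \<open>M\<close> is the cone of the split monomorphism \<open>q : N \<rightarrow> M\<close>. The
  last map of the triangle vanishes, because its composite with the split monomorphism \<open>q[1]\<close> does,
  so \<open>M \<rightarrow> C\<close> has a section.
\<close>

lemma direct_summand_iff_retract: "direct_summand T N M \<longleftrightarrow> retract N M"
proof
  assume "retract N M"
  then obtain q p where 1: "q \<in> Hom T N M" "p \<in> Hom T M N" "p \<bullet> q = Ident T N"
    unfolding retract_def by blast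
  obtain C g h where t: "Tri T N M C q g h" using TR1_cone[OF 1(1)] by blast
  have H: "g \<in> Hom T M C" "h \<in> Hom T C (Shift T N)" using Tri_in_Hom[OF t] by auto
  have gq: "g \<bullet> q = 0" by (rule Tri_comp_zero[OF t])
  have "ShiftM T (p \<bullet> q) \<bullet> h = 0"
    using Comp_assoc[OF H(2) ShiftM_in_Hom[OF 1(1)] ShiftM_in_Hom[OF 1(2)]]
      ShiftM_Comp[OF 1(1,2)] Tri_comp_zero'(2)[OF t] Comp_zero_right[OF ShiftM_in_Hom[OF 1(2)]]
    by simp
  then have "h = 0" using 1(3) ShiftM_Ident Comp_Ident_left[OF H(2)] by simp
  then have "h \<bullet> Ident T C = 0" using Comp_zero_left[OF Ident_in_Hom] by simp
  from Hom_exact_covariant[OF Tri_rotate[OF t] Ident_in_Hom this]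
  obtain s where s: "s \<in> Hom T C M" "g \<bullet> s = Ident T C" by auto
  have ps: "p \<bullet> s \<in> Hom T C N" by (rule Comp_in_Hom[OF s(1) 1(2)])
  have qps: "q \<bullet> (p \<bullet> s) \<in> Hom T C M" by (rule Comp_in_Hom[OF ps 1(1)])
  \<comment> \<open>Correct the section so that the retraction \<open>p\<close> vanishes on it.\<close>
  define s' where "s' = s - q \<bullet> (p \<bullet> s)"
  have s': "s' \<in> Hom T C M" unfolding s'_def by (rule diff_in_Hom[OF s(1) qps])
  have "p \<bullet> (q \<bullet> (p \<bullet> s)) = p \<bullet> s"
    using Comp_assoc[OF ps 1(1,2)] 1(3) Comp_Ident_left[OF ps] by simp
  then have ps': "p \<bullet> s' = 0"
    unfolding s'_def using Comp_diff_right[OF s(1) qps 1(2)] by simp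
  have "g \<bullet> (q \<bullet> (p \<bullet> s)) = 0"
    using Comp_assoc[OF ps 1(1) H(1)] gq Comp_zero_left[OF ps] by simp
  then have gs': "g \<bullet> s' = Ident T C"
    unfolding s'_def using Comp_diff_right[OF s(1) qps H(1)] s(2) by simp
  have qp: "q \<bullet> p \<in> Hom T M M" and sg: "s' \<bullet> g \<in> Hom T M M"
    using Comp_in_Hom[OF 1(2,1)] Comp_in_Hom[OF H(1) s'] by auto
  \<comment> \<open>The failure of the two idempotents to sum to the identity is killed by \<open>g\<close>, hence factors
    through \<open>q\<close>; it is also killed by \<open>p\<close>, so it is zero.\<close>
  let ?d = "Ident T M - q \<bullet> p - s' \<bullet> g"
  have d1: "Ident T M - q \<bullet> p \<in> Hom T M M" by (rule diff_in_Hom[OF Ident_in_Hom qp])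
  have d: "?d \<in> Hom T M M" by (rule diff_in_Hom[OF d1 sg])
  have k: "k \<bullet> ?d = k - (k \<bullet> q) \<bullet> p - (k \<bullet> s') \<bullet> g" if "k \<in> Hom T M Y" for k Y
    using Comp_diff_right[OF d1 sg that] Comp_diff_right[OF Ident_in_Hom qp that]
      Comp_Ident_right[OF that] Comp_assoc[OF 1(2,1) that] Comp_assoc[OF H(1) s' that] by simp
  have "g \<bullet> ?d = 0"
    unfolding k[OF H(1)] using gq gs' Comp_zero_left[OF 1(2)] Comp_Ident_left[OF H(1)] by simp
  then obtain t' where t': "t' \<in> Hom T M N" "?d = q \<bullet> t'"
    using Hom_exact_covariant[OF t d] by blast
  have "t' = p \<bullet> ?d" unfolding t'(2)
    using Comp_assoc[OF t'(1) 1(1,2)] 1(3) Comp_Ident_left[OF t'(1)] by simp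
  also have "\<dots> = 0"
    unfolding k[OF 1(2)] using 1(3) ps' Comp_zero_left[OF H(1)] Comp_Ident_left[OF 1(2)] by simp
  finally have "?d = 0" using t'(2) Comp_zero_right[OF 1(1)] by simp
  then have "q \<bullet> p + s' \<bullet> g = Ident T M" by (simp add: algebra_simps)
  then have "is_direct_sum T M [N, C]"
    using biproductI[OF 1(1) s' 1(2) H(1) 1(3) gs' ps' gq] by blast
  then show "direct_summand T N M" unfolding direct_summand_def by blast
qed (rule direct_summand_retract)

section \<open>Additive closures\<close>

text \<open>
  Here the Krull-Schmidt property enters: split \<open>Z\<close> into objects with local endomorphism rings
  and place each of them inside a summand of \<open>M\<close>.
\<close>

lemma add_closed_retract:
  assumes KS: "Krull_Schmidt T" and P: "P \<in> add T M" and r: "retract Z P"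
  shows "Z \<in> add T M"
proof -
  obtain Xs where Xs: "is_direct_sum T P Xs" "\<forall>N\<in>set Xs. direct_summand T N M"
    using P unfolding add_def by blast
  obtain Ys where Ys: "is_direct_sum T Z Ys" "\<forall>Y\<in>set Ys. local_End T Y"
    using KS unfolding Krull_Schmidt_def by blast
  have "direct_summand T Y M" if Y: "Y \<in> set Ys" for Y
  proof -
    have "retract Y P" using retract_trans[OF retract_of_direct_sum[OF Ys(1) Y] r] .
    then obtain N where "N \<in> set Xs" "retract Y N"
      using local_retract_direct_sum[OF _ Xs(1)] Ys(2) Y by blast
    then show ?thesis using Xs(2) retract_trans direct_summand_iff_retract by blast
  qed
  then show ?thesis unfolding add_def using Ys(1) by blast
qed

lemma direct_sum_Shift:
  assumes "is_direct_sum T P Xs"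
  shows "is_direct_sum T (Shift T P) (map (Shift T) Xs)"
proof -
  obtain \<iota> \<pi> where s: "\<And>a. a < length Xs \<Longrightarrow> \<iota> a \<in> Hom T (Xs ! a) P"
    "\<And>a. a < length Xs \<Longrightarrow> \<pi> a \<in> Hom T P (Xs ! a)"
    "\<And>a b. a < length Xs \<Longrightarrow> b < length Xs \<Longrightarrow>
        \<pi> a \<bullet> \<iota> b = (if a = b then Ident T (Xs ! a) else 0)"
    "(\<Sum>a<length Xs. \<iota> a \<bullet> \<pi> a) = Ident T P"
    by (rule direct_sumE[OF assms]) blast
  have "(\<Sum>a<length Xs. ShiftM T (\<iota> a) \<bullet> ShiftM T (\<pi> a)) = ShiftM T (\<Sum>a<length Xs. \<iota> a \<bullet> \<pi> a)"
    using ShiftM_Comp[OF s(2,1)] Comp_in_Hom[OF s(2,1)] by (subst ShiftM_sum) auto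
  moreover have "ShiftM T (\<pi> a) \<bullet> ShiftM T (\<iota> b) =
      (if a = b then Ident T (Shift T (Xs ! a)) else 0)" if "a < length Xs" "b < length Xs" for a b
    using ShiftM_Comp[OF s(1,2), OF that(2,1)] s(3)[OF that] ShiftM_Ident ShiftM_zero by (metis (full_types))
  ultimately show ?thesis
    unfolding is_direct_sum_def using s(4) ShiftM_in_Hom[OF s(1)] ShiftM_in_Hom[OF s(2)] ShiftM_Ident
    by (intro exI[of _ "\<lambda>a. ShiftM T (\<iota> a)"] exI[of _ "\<lambda>a. ShiftM T (\<pi> a)"]) simp
qed

lemma add_Shift:
  assumes "P \<in> add T M" shows "Shift T P \<in> add T (Shift T M)"
proof -
  obtain Xs where Xs: "is_direct_sum T P Xs" "\<forall>N\<in>set Xs. direct_summand T N M"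
    using assms unfolding add_def by blast
  have "\<forall>N\<in>set (map (Shift T) Xs). direct_summand T N (Shift T M)"
    using Xs(2) direct_sum_Shift[of M "[_, _]"] unfolding direct_summand_def by fastforce
  then show ?thesis unfolding add_def using direct_sum_Shift[OF Xs(1)] by blast
qed

lemma add_shift_iter: "P \<in> add T M \<Longrightarrow> shift_iter i P \<in> add T (shift_iter i M)"
  by (induction i) (auto intro: add_Shift)

lemma direct_sum_replicate_in_add:
  "is_direct_sum T P (replicate n M) \<Longrightarrow> P \<in> add T M"
  unfolding add_def using direct_summand_iff_retract retract_refl by (auto simp: in_set_replicate)


lemma shift_iter_Shift: "shift_iter i (Shift T X) = shift_iter (Suc i) X"
  by (simp add: funpow_swap1)

text \<open>
  A map \<open>X \<rightarrow> W'[1]\<close> dies in \<open>P[1]\<close> since \<open>X\<close> is rigid, hence comes from a map \<open>X \<rightarrow> W\<close>. That map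
  factors through the approximation \<open>P \<rightarrow> W\<close> and so goes to zero in \<open>W'[1]\<close>.
\<close>

lemma approximation_triangle:
  assumes fin: "Hom_finite T" and r: "Hom T X (Shift T X) = {0}"
  shows "\<exists>P W'. P \<in> add T X \<and> exact_triangle T W' P W \<and> Hom T X (Shift T W') = {0}"
proof -
  obtain P n p where P: "is_direct_sum T P (replicate n X)" "p \<in> Hom T P W"
    "\<And>f. f \<in> Hom T X W \<Longrightarrow> \<exists>u\<in>Hom T X P. f = p \<bullet> u"
    using approximation[OF fin direct_sums, of X W] by blast
  have PX: "P \<in> add T X" by (rule direct_sum_replicate_in_add[OF P(1)])
  obtain W' a h where t: "Tri T W' P W a p h" using Tri_cocone[OF P(2)] by blast
  have H: "a \<in> Hom T W' P" "h \<in> Hom T W (Shift T W')" using Tri_in_Hom[OF t] by auto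
  have hp: "h \<bullet> p = 0" by (rule Tri_comp_zero'(1)[OF t])
  have XP: "Hom T X (Shift T P) = {0}" by (rule Hom_add_target[OF add_Shift[OF PX] r])
  have "Hom T X (Shift T W') = {0}"
  proof (rule Hom_zeroI)
    fix f assume f: "f \<in> Hom T X (Shift T W')"
    have "(- ShiftM T a) \<bullet> f = 0"
      using Comp_in_Hom[OF f uminus_in_Hom[OF ShiftM_in_Hom[OF H(1)]]] XP by simp
    then obtain u where u: "u \<in> Hom T X W" "f = h \<bullet> u"
      using Hom_exact_covariant[OF Tri_rotate[OF Tri_rotate[OF t]] f] by blast
    obtain u' where u': "u' \<in> Hom T X P" "u = p \<bullet> u'" using P(3)[OF u(1)] by blast
    show "f = 0"
      using Comp_assoc[OF u'(1) P(2) H(2)] hp u(2) u'(2) Comp_zero_left[OF u'(1)] by simp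
  qed
  then show ?thesis using PX t unfolding exact_triangle_def by blast
qed

section \<open>Thick subcategories\<close>

lemma thick_cone:
  "thick T C \<Longrightarrow> exact_triangle T X Y Z \<Longrightarrow> X \<in> C \<Longrightarrow> Y \<in> C \<Longrightarrow> Z \<in> C"
  unfolding thick_def exact_triangle_def by blast

lemma thick_Shift_iff: "thick T C \<Longrightarrow> Shift T X \<in> C \<longleftrightarrow> X \<in> C"
  unfolding thick_def by blast

lemma thick_retract: "thick T C \<Longrightarrow> retract N M \<Longrightarrow> M \<in> C \<Longrightarrow> N \<in> C"
  unfolding thick_def using direct_summand_iff_retract by blast

lemma thick_cocone:
  "thick T C \<Longrightarrow> exact_triangle T X Y Z \<Longrightarrow> Y \<in> C \<Longrightarrow> Z \<in> C \<Longrightarrow> X \<in> C"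
  using thick_cone[OF _ exact_triangle_rotate] thick_Shift_iff by blast

lemma thick_extension:
  "thick T C \<Longrightarrow> exact_triangle T X Y Z \<Longrightarrow> X \<in> C \<Longrightarrow> Z \<in> C \<Longrightarrow> Y \<in> C"
  using thick_cocone[OF _ exact_triangle_rotate] thick_Shift_iff by blast

text \<open>
  The cone \<open>V\<close> of the inclusion \<open>A \<rightarrow> P\<close> is a retract of \<open>B\<close> (in fact isomorphic to it), so \<open>P\<close> is
  an extension of two objects of \<open>C\<close>.
\<close>

lemma thick_biproduct:
  assumes C: "thick T C" and P: "is_direct_sum T P [A, B]" and AB: "A \<in> C" "B \<in> C"
  shows "P \<in> C"
proof -
  obtain i j p q where b: "i \<in> Hom T A P" "j \<in> Hom T B P" "p \<in> Hom T P A" "q \<in> Hom T P B"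
    "p \<bullet> i = Ident T A" "q \<bullet> i = 0" "i \<bullet> p + j \<bullet> q = Ident T P"
    by (rule biproductE[OF P]) blast
  obtain V g h where t: "Tri T A P V i g h" using TR1_cone[OF b(1)] by blast
  have H: "g \<in> Hom T P V" "h \<in> Hom T V (Shift T A)" using Tri_in_Hom[OF t] by auto
  have "ShiftM T (p \<bullet> i) \<bullet> h = 0"
    using Comp_assoc[OF H(2) ShiftM_in_Hom[OF b(1)] ShiftM_in_Hom[OF b(3)]]
      ShiftM_Comp[OF b(1,3)] Tri_comp_zero'(2)[OF t] Comp_zero_right[OF ShiftM_in_Hom[OF b(3)]]
    by simp
  then have h: "h = 0" using b(5) ShiftM_Ident Comp_Ident_left[OF H(2)] by simp
  obtain w where w: "w \<in> Hom T V B" "q = w \<bullet> g"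
    using Hom_exact_contravariant[OF t b(4,6)] by blast
  have s: "g \<bullet> j \<in> Hom T B V" by (rule Comp_in_Hom[OF b(2) H(1)])
  have sw: "(g \<bullet> j) \<bullet> w \<in> Hom T V V" by (rule Comp_in_Hom[OF w(1) s])
  have "g = g \<bullet> (i \<bullet> p + j \<bullet> q)" using b(7) Comp_Ident_right[OF H(1)] by simp
  also have "\<dots> = g \<bullet> (i \<bullet> p) + g \<bullet> (j \<bullet> q)"
    by (rule Comp_add_right[OF Comp_in_Hom[OF b(3,1)] Comp_in_Hom[OF b(4,2)] H(1)])
  also have "g \<bullet> (i \<bullet> p) = 0"
    using Comp_assoc[OF b(3,1) H(1)] Tri_comp_zero[OF t] Comp_zero_left[OF b(3)] by simp
  also have "g \<bullet> (j \<bullet> q) = ((g \<bullet> j) \<bullet> w) \<bullet> g"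
    using Comp_assoc[OF b(4,2) H(1)] w(2) Comp_assoc[OF H(1) w(1) s] by simp
  finally have "((g \<bullet> j) \<bullet> w - Ident T V) \<bullet> g = 0"
    using Comp_diff_left[OF H(1) sw Ident_in_Hom] Comp_Ident_left[OF H(1)] by simp
  \<comment> \<open>So the difference factors through the last map of the triangle, which is zero.\<close>
  from Hom_exact_contravariant[OF Tri_rotate[OF t] diff_in_Hom[OF sw Ident_in_Hom] this]
  have "(g \<bullet> j) \<bullet> w - Ident T V = 0" using h Comp_zero_right by metis
  then have "retract V B" unfolding retract_def using w(1) s by auto
  then have "V \<in> C" using thick_retract[OF C] AB(2) by blast
  then show ?thesis
    using thick_extension[OF C] t AB(1) unfolding exact_triangle_def by blast
qed

lemma thick_direct_sum:
  assumes C: "thick T C"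
  shows "is_direct_sum T P Xs \<Longrightarrow> set Xs \<subseteq> C \<Longrightarrow> P \<in> C"
proof (induction Xs arbitrary: P)
  case Nil
  then have "zero_object T P" unfolding is_direct_sum_def by (intro zero_objectI) simp
  moreover obtain M where "M \<in> C" using C unfolding thick_def by blast
  ultimately show ?case
    using thick_cone[OF C] TR1_Ident unfolding exact_triangle_def by blast
next
  case (Cons x xs)
  obtain Q where Q: "is_direct_sum T Q xs" using direct_sums by blast
  show ?case
    using thick_biproduct[OF C direct_sum_Cons[OF Cons.prems(1) Q]] Cons.IH[OF Q] Cons.prems(2)
    by simp
qed

lemma thick_add: "thick T C \<Longrightarrow> M \<in> C \<Longrightarrow> P \<in> add T M \<Longrightarrow> P \<in> C"
  using thick_direct_sum thick_retract direct_summand_iff_retract unfolding add_def by blast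

definition right_perp :: "'o \<Rightarrow> 'o set" where
  "right_perp S = {W. \<forall>i>0. Hom T S (shift_iter i W) = {0}}"

lemma presilting_iff: "presilting T S \<longleftrightarrow> S \<in> right_perp S"
  unfolding presilting_def right_perp_def by simp

lemma right_perpD: "W \<in> right_perp S \<Longrightarrow> i > 0 \<Longrightarrow> Hom T S (shift_iter i W) = {0}"
  unfolding right_perp_def by blast

lemma right_perp_add: "W \<in> right_perp S \<Longrightarrow> P \<in> add T W \<Longrightarrow> P \<in> right_perp S"
  unfolding right_perp_def using Hom_add_target[OF add_shift_iter] by blast

lemma retract_of_isomorphic: "isomorphic T X Y \<Longrightarrow> retract Y X"
  unfolding isomorphic_def is_iso_def retract_def by blast

text \<open>
  The bound \<open>N\<close> is uniform in \<open>W\<close>. This is what lets \<open>silting_absorbs\<close> use it for all the iterated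
  cocones of \<open>Z\<close> at once. Shifting \<open>Y\<close> moves the bound by one, and along a triangle one takes a
  maximum.
\<close>

lemma thick_eventually_vanishing:
  "thick T {Y. \<exists>N. \<forall>W\<in>right_perp S. \<forall>n\<ge>N. Hom T Y (shift_iter n W) = {0}}"
    (is "thick T ?D")
  unfolding thick_def
proof (intro conjI allI impI)
  show "?D \<noteq> {}" using right_perpD[of _ S] by (auto intro!: exI[of _ S] exI[of _ "1::nat"])
next
  fix X Y assume "X \<in> ?D \<and> isomorphic T X Y"
  then show "Y \<in> ?D" using Hom_retract_source[OF retract_of_isomorphic] by blast
next
  fix M N assume "M \<in> ?D \<and> direct_summand T N M"
  then show "N \<in> ?D" using Hom_retract_source[OF direct_summand_retract] by blast
next
  have shift: "Hom T (Shift T X) (shift_iter (Suc n) W) = {0} \<longleftrightarrow> Hom T X (shift_iter n W) = {0}"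
    for X W n by (simp add: Hom_Shift_zero_iff)
  have up: "Shift T X \<in> ?D" if X: "X \<in> ?D" for X
  proof -
    obtain N where N: "\<And>W n. W \<in> right_perp S \<Longrightarrow> n \<ge> N \<Longrightarrow> Hom T X (shift_iter n W) = {0}"
      using X by blast
    have "Hom T (Shift T X) (shift_iter n W) = {0}" if "W \<in> right_perp S" "n \<ge> Suc N" for W n
      using N[OF that(1), of "n - 1"] shift[of X "n - 1" W] that(2) by simp
    then show ?thesis by blast
  qed
  have down: "X \<in> ?D" if X: "Shift T X \<in> ?D" for X
  proof -
    obtain N where N: "\<And>W n. W \<in> right_perp S \<Longrightarrow> n \<ge> N \<Longrightarrow>
        Hom T (Shift T X) (shift_iter n W) = {0}"
      using X by blast
    have "Hom T X (shift_iter n W) = {0}" if "W \<in> right_perp S" "n \<ge> N" for W n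
      using N[OF that(1), of "Suc n"] that(2) shift[of X n W] by simp
    then show ?thesis by blast
  qed
  show "Shift T X \<in> ?D \<longleftrightarrow> X \<in> ?D" for X by (rule iffI[OF down up])
  fix X Y Z f g h
  assume a: "Tri T X Y Z f g h \<and> X \<in> ?D \<and> Y \<in> ?D"
  then have t: "exact_triangle T Y Z (Shift T X)"
    by (intro exact_triangle_rotate) (auto simp: exact_triangle_def)
  have "Y \<in> ?D" using a by (elim conjE)
  then obtain N where N: "\<forall>W\<in>right_perp S. \<forall>n\<ge>N. Hom T Y (shift_iter n W) = {0}"
    by (elim CollectE exE)
  have "Shift T X \<in> ?D" by (rule up) (use a in \<open>elim conjE\<close>)
  then obtain N' where N': "\<forall>W\<in>right_perp S. \<forall>n\<ge>N'. Hom T (Shift T X) (shift_iter n W) = {0}"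
    by (elim CollectE exE)
  show "Z \<in> ?D"
  proof (intro CollectI exI[of _ "max N N'"] ballI allI impI)
    fix W n assume "W \<in> right_perp S" "n \<ge> max N N'"
    then show "Hom T Z (shift_iter n W) = {0}"
      using Hom_zero_middle_source[OF t] N N' by simp
  qed
qed

section \<open>Silting objects\<close>

text \<open>
  In degree one this is the approximation property, in higher degrees the long exact sequence.
\<close>

lemma right_perp_approximation:
  assumes fin: "Hom_finite T" and S: "presilting T S" and W: "W \<in> right_perp S"
  shows "\<exists>P W'. P \<in> add T S \<and> exact_triangle T W' P W \<and> W' \<in> right_perp S"
proof -
  have SS: "S \<in> right_perp S" using S presilting_iff by blast
  have "Hom T S (Shift T S) = {0}" using right_perpD[OF SS, of 1] by simp
  from approximation_triangle[OF fin this, of W]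
  obtain P W' where P: "P \<in> add T S" and t: "exact_triangle T W' P W"
    and 1: "Hom T S (Shift T W') = {0}"
    by blast
  have PS: "P \<in> right_perp S" by (rule right_perp_add[OF SS P])
  have "Hom T S (shift_iter i W') = {0}" if "i > 0" for i
  proof (cases "i = 1")
    case True
    then show ?thesis using 1 by simp
  next
    case False
    define j where "j = i - 1"
    have j: "j > 0" "i = Suc j" using False that unfolding j_def by auto
    have "exact_triangle T (shift_iter j W) (shift_iter j (Shift T W')) (shift_iter j (Shift T P))"
      by (intro exact_triangle_shift_iter exact_triangle_rotate t)
    from Hom_zero_middle_target[OF this right_perpD[OF W j(1)]]
    show ?thesis
      unfolding shift_iter_Shift j(2) using right_perpD[OF PS, of "Suc j"] by blast
  qed
  then show ?thesis using P t unfolding right_perp_def by blast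
qed

text \<open>
  \<open>Hom(Z, W[n])\<close> embeds into \<open>Hom(Z, W'[n+1])\<close> for the cocone \<open>W'\<close> of an approximation of \<open>W\<close>,
  because \<open>Hom(Z, P[n]) = 0\<close> for \<open>P \<in> add S\<close>. For large \<open>n\<close> these spaces vanish uniformly in \<open>W\<close>,
  so by descending induction they vanish for all \<open>n > 0\<close>. For \<open>W = Z_1\<close>, the cocone of an
  approximation of \<open>Z\<close>, and \<open>n = 1\<close> this says that the approximation of \<open>Z\<close> splits.
\<close>

lemma silting_absorbs:
  assumes fin: "Hom_finite T" and KS: "Krull_Schmidt T" and S: "silting T S"
    and Z: "Z \<in> right_perp S" and ZS: "S \<in> right_perp Z"
  shows "Z \<in> add T S"
proof -
  have pS: "presilting T S" using S unfolding silting_def by blast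
  let ?D = "{Y. \<exists>N. \<forall>W\<in>right_perp S. \<forall>n\<ge>N. Hom T Y (shift_iter n W) = {0}}"
  have "S \<in> ?D" using right_perpD[of _ S] by (auto intro!: exI[of _ "1::nat"])
  then have "thick_closure T S \<subseteq> ?D"
    unfolding thick_closure_def using thick_eventually_vanishing[of S] by blast
  then have "Z \<in> ?D" using S unfolding silting_def by blast
  then obtain N where N: "\<And>W n. W \<in> right_perp S \<Longrightarrow> n \<ge> N \<Longrightarrow> Hom T Z (shift_iter n W) = {0}"
    by blast
  have van: "Hom T Z (shift_iter n W) = {0}" if "n > 0" "W \<in> right_perp S" for n W
    using that
  proof (induction "N - n" arbitrary: n W)
    case 0
    then show ?case using N by simp
  next
    case (Suc m)
    obtain P W' where P: "P \<in> add T S" and t: "exact_triangle T W' P W" and W': "W' \<in> right_perp S"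
      using right_perp_approximation[OF fin pS Suc.prems(2)] by blast
    have "Hom T Z (shift_iter n P) = {0}"
      using right_perpD[OF right_perp_add[OF ZS P] Suc.prems(1)] .
    moreover have "Hom T Z (shift_iter n (Shift T W')) = {0}"
      unfolding shift_iter_Shift by (rule Suc.hyps(1)) (use Suc.hyps(2) W' in auto)
    ultimately show ?case
      using Hom_zero_middle_target[OF exact_triangle_shift_iter[OF exact_triangle_rotate[OF t]]] by blast
  qed
  obtain P W' where P: "P \<in> add T S" and t: "exact_triangle T W' P Z" and W': "W' \<in> right_perp S"
    using right_perp_approximation[OF fin pS Z] by blast
  obtain a p h where tr: "Tri T W' P Z a p h" using t unfolding exact_triangle_def by blast
  have H: "p \<in> Hom T P Z" "h \<in> Hom T Z (Shift T W')" using Tri_in_Hom[OF tr] by auto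
  have "h \<bullet> Ident T Z = 0"
    using H(2) van[OF _ W', of 1] Comp_zero_left[OF Ident_in_Hom] by simp
  then obtain s where "s \<in> Hom T Z P" "Ident T Z = p \<bullet> s"
    using Hom_exact_covariant[OF Tri_rotate[OF tr] Ident_in_Hom] by blast
  then have "retract Z P" unfolding retract_def using H(1) by auto
  then show ?thesis by (rule add_closed_retract[OF KS P])
qed

section \<open>Objects presented by a rigid object\<close>

lemma pr_iff:
  "X \<in> pr T R \<longleftrightarrow> (\<exists>R1\<in>add T R. \<exists>R0\<in>add T R. exact_triangle T R1 R0 X)"
  unfolding pr_def exact_triangle_def by blast

lemma pr_right_perp:
  assumes R: "presilting T R" and X: "X \<in> pr T R"
  shows "X \<in> right_perp R"
proof -
  have RR: "R \<in> right_perp R" using R presilting_iff by blast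
  obtain R1 R0 where r: "R1 \<in> add T R" "R0 \<in> add T R" and t: "exact_triangle T R1 R0 X"
    using X unfolding pr_iff by blast
  have "Hom T R (shift_iter i X) = {0}" if "i > 0" for i
  proof -
    have "Hom T R (shift_iter i (Shift T R1)) = {0}"
      unfolding shift_iter_Shift using right_perpD[OF right_perp_add[OF RR r(1)]] by blast
    then show ?thesis
      using Hom_zero_middle_target[OF exact_triangle_shift_iter[OF exact_triangle_rotate[OF t]]]
        right_perpD[OF right_perp_add[OF RR r(2)] that] by blast
  qed
  then show ?thesis unfolding right_perp_def by blast
qed

text \<open>
  \<open>X\<close> is an extension of \<open>R1[1]\<close> by \<open>R0\<close>, and one of the \<open>i\<close> shifts is used up by \<open>R1[1]\<close>; hence
  the bound \<open>i > 1\<close>.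
\<close>

lemma pr_Hom_vanish:
  assumes X: "X \<in> pr T R" and Y: "Y \<in> right_perp R" and i: "i > 1"
  shows "Hom T X (shift_iter i Y) = {0}"
proof -
  obtain R1 R0 where r: "R1 \<in> add T R" "R0 \<in> add T R" and t: "exact_triangle T R1 R0 X"
    using X unfolding pr_iff by blast
  have "Hom T R0 (shift_iter i Y) = {0}"
    using Hom_add_source[OF r(2) right_perpD[OF Y]] i by simp
  moreover have "Hom T R1 (shift_iter (i - 1) Y) = {0}"
    using Hom_add_source[OF r(1) right_perpD[OF Y]] i by simp
  then have "Hom T (Shift T R1) (Shift T (shift_iter (i - 1) Y)) = {0}"
    using Hom_Shift_zero_iff by blast
  moreover have "Shift T (shift_iter (i - 1) Y) = shift_iter i Y"
    using i by (cases i) auto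
  ultimately show ?thesis using Hom_zero_middle_source[OF exact_triangle_rotate[OF t]] by simp
qed

lemma factoring_subset_Hom: "factoring T Z X Y \<subseteq> Hom T X Y"
  unfolding factoring_def using Comp_in_Hom by blast

lemma zero_in_factoring: "0 \<in> factoring T Z X Y"
proof -
  obtain P where "is_direct_sum T P []" using direct_sums by blast
  then have "P \<in> add T Z" unfolding add_def by (auto intro!: exI[of _ "[]"])
  moreover have "0 = 0 \<bullet> (0 :: 'm)" using Comp_zero_left[OF zero_in_Hom] by simp
  ultimately show ?thesis unfolding factoring_def using zero_in_Hom by blast
qed

text \<open>
  As \<open>Hom(R0, Y) = 0\<close>, every map \<open>X \<rightarrow> Y\<close> vanishes on \<open>R0\<close> and so factors over \<open>X \<rightarrow> R1[1]\<close>.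
\<close>

lemma pr_factoring:
  assumes X: "X \<in> pr T R" and Y: "Hom T R Y = {0}"
  shows "factoring T (Shift T R) X Y = Hom T X Y"
proof (intro equalityI subsetI)
  fix v assume v: "v \<in> Hom T X Y"
  obtain R1 R0 f g h where r: "R1 \<in> add T R" "R0 \<in> add T R" and t: "Tri T R1 R0 X f g h"
    using X unfolding pr_def by blast
  have H: "g \<in> Hom T R0 X" "h \<in> Hom T X (Shift T R1)" using Tri_in_Hom[OF t] by auto
  have "v \<bullet> g = 0" using Comp_in_Hom[OF H(1) v] Hom_add_source[OF r(2) Y] by simp
  then obtain w where "w \<in> Hom T (Shift T R1) Y" "v = w \<bullet> h"
    using Hom_exact_contravariant[OF Tri_rotate[OF t] v] by blast
  then show "v \<in> factoring T (Shift T R) X Y"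
    unfolding factoring_def using H(2) add_Shift[OF r(1)] by blast
qed (use factoring_subset_Hom in blast)

text \<open>
  Maps factoring through \<open>add M\<close> form a two-sided ideal. This allows passing from \<open>X \<oplus> Z\<close> to its
  summands in the definition of maximality.
\<close>

lemma factoring_zero_retract:
  assumes z: "factoring T M X' Y' = {0}" and X: "retract X X'" and Y: "retract Y Y'"
  shows "factoring T M X Y = {0}"
proof -
  obtain i p where i: "i \<in> Hom T X X'" "p \<in> Hom T X' X" "p \<bullet> i = Ident T X"
    using X unfolding retract_def by blast
  obtain j q where j: "j \<in> Hom T Y Y'" "q \<in> Hom T Y' Y" "q \<bullet> j = Ident T Y"
    using Y unfolding retract_def by blast
  have "v = 0" if v': "v \<in> factoring T M X Y" for v
  proof -
    obtain g f W where v: "v = g \<bullet> f" "W \<in> add T M" "f \<in> Hom T X W" "g \<in> Hom T W Y"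
      using v' unfolding factoring_def by blast
    have fp: "f \<bullet> p \<in> Hom T X' W" and jg: "j \<bullet> g \<in> Hom T W Y'"
      using Comp_in_Hom[OF i(2) v(3)] Comp_in_Hom[OF v(4) j(1)] by auto
    then have "(j \<bullet> g) \<bullet> (f \<bullet> p) \<in> factoring T M X' Y'"
      unfolding factoring_def using v(2) by blast
    then have 0: "(j \<bullet> g) \<bullet> (f \<bullet> p) = 0" using z by simp
    have gfp: "g \<bullet> (f \<bullet> p) \<in> Hom T X' Y" by (rule Comp_in_Hom[OF fp v(4)])
    have "g \<bullet> (f \<bullet> p) = q \<bullet> (j \<bullet> (g \<bullet> (f \<bullet> p)))"
      using Comp_assoc[OF gfp j(1,2)] j(3) Comp_Ident_left[OF gfp] by simp
    also have "\<dots> = 0"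
      using Comp_assoc[OF fp v(4) j(1)] 0 Comp_zero_right[OF j(2)] by simp
    finally have gfp0: "g \<bullet> (f \<bullet> p) = 0" .
    have "f = (f \<bullet> p) \<bullet> i"
      using Comp_assoc[OF i(1,2) v(3)] i(3) Comp_Ident_right[OF v(3)] by simp
    then show "v = 0"
      using Comp_assoc[OF i(1) fp v(4)] gfp0 Comp_zero_left[OF i(1)] v(1) by simp
  qed
  then show ?thesis using zero_in_factoring by blast
qed

lemma dsum_direct_sum: "is_direct_sum T (X \<oplus> Y) [X, Y]"
  unfolding dsum_def using direct_sums by (rule someI_ex)

lemma retract_dsum: "retract X (X \<oplus> Y)" "retract Y (X \<oplus> Y)"
  using retract_of_direct_sum[OF dsum_direct_sum] by auto

text \<open>
  Degree one is governed by maps through \<open>add R[1]\<close>, higher degrees vanish anyway.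
\<close>

lemma pr_right_perp_of_factoring:
  assumes R: "presilting T R" and XY: "X \<in> pr T R" "Y \<in> pr T R"
    and z: "factoring T (Shift T R) X (Shift T Y) = {0}"
  shows "Y \<in> right_perp X"
proof -
  have Y: "Y \<in> right_perp R" by (rule pr_right_perp[OF R XY(2)])
  have "Hom T X (Shift T Y) = {0}"
    using pr_factoring[OF XY(1)] right_perpD[OF Y, of 1] z by simp
  then have "Hom T X (shift_iter i Y) = {0}" if "i > 0" for i
    using that pr_Hom_vanish[OF XY(1) Y] by (cases "i = 1") auto
  then show ?thesis unfolding right_perp_def by blast
qed

lemma presilting_equivalences:
  assumes R: "presilting T R" and X: "X \<in> pr T R"
  shows "shift_rigid T R X \<longleftrightarrow> rigid T X" "rigid T X \<longleftrightarrow> presilting T X"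
proof -
  have 1: "rigid T X \<Longrightarrow> shift_rigid T R X"
    unfolding rigid_def shift_rigid_def using factoring_subset_Hom zero_in_factoring by blast
  have 2: "shift_rigid T R X \<Longrightarrow> presilting T X"
    unfolding shift_rigid_def presilting_iff by (rule pr_right_perp_of_factoring[OF R X X])
  have 3: "presilting T X \<Longrightarrow> rigid T X"
    unfolding presilting_iff rigid_def using right_perpD[of X X 1] by simp
  show "shift_rigid T R X \<longleftrightarrow> rigid T X" "rigid T X \<longleftrightarrow> presilting T X" using 1 2 3 by blast+
qed

text \<open>
  The cocone \<open>Y'\<close> of an \<open>add R\<close>-approximation of \<open>Y\<close> satisfies the hypotheses of
  \<open>silting_absorbs\<close>, so it lies in \<open>add R\<close> and \<open>Y' \<rightarrow> R0 \<rightarrow> Y\<close> is the required presentation. The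
  point of this criterion is that vanishing conditions pass to extensions, so that no presentation
  of an extension has to be assembled from presentations of its ends.
\<close>

lemma silting_pr_if_vanishing:
  assumes fin: "Hom_finite T" and KS: "Krull_Schmidt T" and R: "silting T R"
    and Y: "Y \<in> right_perp R" and YR: "\<And>i. i > 1 \<Longrightarrow> Hom T Y (shift_iter i R) = {0}"
  shows "Y \<in> pr T R"
proof -
  have pR: "presilting T R" using R unfolding silting_def by blast
  then have RR: "R \<in> right_perp R" using presilting_iff by blast
  obtain R0 Y' where R0: "R0 \<in> add T R" and t: "exact_triangle T Y' R0 Y" and Y': "Y' \<in> right_perp R"
    using right_perp_approximation[OF fin pR Y] by blast
  have "Hom T Y' (shift_iter i R) = {0}" if i: "i > 0" for i
  proof -
    have "Hom T (Shift T R0) (shift_iter (Suc i) R) = {0}"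
      using Hom_add_source[OF R0 right_perpD[OF RR i]] by (simp add: Hom_Shift_zero_iff)
    moreover have "Hom T Y (shift_iter (Suc i) R) = {0}" by (rule YR) (use i in simp)
    ultimately have "Hom T (Shift T Y') (shift_iter (Suc i) R) = {0}"
      using Hom_zero_middle_source[OF exact_triangle_rotate[OF exact_triangle_rotate[OF t]]] by blast
    then show ?thesis by (simp add: Hom_Shift_zero_iff)
  qed
  then have "Y' \<in> add T R"
    using silting_absorbs[OF fin KS R Y'] unfolding right_perp_def by blast
  then show ?thesis unfolding pr_iff using R0 t by blast
qed

section \<open>Maximality and Bongartz completion\<close>

lemma silting_imp_maximal:
  assumes fin: "Hom_finite T" and KS: "Krull_Schmidt T" and R: "presilting T R"
    and X: "X \<in> pr T R" and S: "silting T X"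
  shows "maximal_shift_rigid T R X"
  unfolding maximal_shift_rigid_def
proof (intro conjI ballI impI)
  show "X \<in> pr T R" by (rule X)
  show "shift_rigid T R X"
    using presilting_equivalences[OF R X] S unfolding silting_def by simp
  fix Z assume Z: "Z \<in> pr T R"
    and z: "factoring T (Shift T R) (X \<oplus> Z) (Shift T X \<oplus> Shift T Z) = {0}"
  have "Z \<in> right_perp X"
    by (rule pr_right_perp_of_factoring[OF R X Z factoring_zero_retract[OF z retract_dsum]])
  moreover have "X \<in> right_perp Z"
    by (rule pr_right_perp_of_factoring[OF R Z X factoring_zero_retract[OF z retract_dsum(2,1)]])
  ultimately show "Z \<in> add T X" by (rule silting_absorbs[OF fin KS S])
qed

text \<open>
  \<open>U\<close> is an extension of \<open>P \<in> add X\<close> by \<open>R\<close>, and all required vanishing follows from this, except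
  \<open>Hom(X, U[1]) = 0\<close>, which holds because \<open>P \<rightarrow> R[1]\<close> is an approximation.
\<close>

lemma bongartz_completion:
  assumes fin: "Hom_finite T" and KS: "Krull_Schmidt T" and R: "silting T R"
    and X: "X \<in> pr T R" and pX: "presilting T X"
  shows "\<exists>U P. U \<in> pr T R \<and> P \<in> add T X \<and> exact_triangle T R U P \<and>
           Hom T X (Shift T U) = {0} \<and> Hom T U (Shift T X) = {0} \<and> Hom T U (Shift T U) = {0}"
proof -
  have pR: "presilting T R" using R unfolding silting_def by blast
  have RR: "R \<in> right_perp R" and XX: "X \<in> right_perp X" using pR pX presilting_iff by auto
  have RX: "X \<in> right_perp R" by (rule pr_right_perp[OF pR X])
  have XX1: "Hom T X (Shift T X) = {0}" using right_perpD[OF XX, of 1] by simp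
  obtain P U where P: "P \<in> add T X" and t': "exact_triangle T U P (Shift T R)"
    and XU: "Hom T X (Shift T U) = {0}"
    using approximation_triangle[OF fin XX1, of "Shift T R"] by blast
  have t: "exact_triangle T R U P" by (rule exact_triangle_unrotate[OF t'])
  have RP: "P \<in> right_perp R" by (rule right_perp_add[OF RX P])
  have RU: "U \<in> right_perp R"
    unfolding right_perp_def
    using Hom_zero_middle_target[OF exact_triangle_shift_iter[OF t]] right_perpD[OF RR]
      right_perpD[OF RP] by blast
  have "Hom T U (shift_iter i R) = {0}" if "i > 1" for i
    by (rule Hom_zero_middle_source[OF t right_perpD[OF RR]
          Hom_add_source[OF P pr_Hom_vanish[OF X RR that]]]) (use that in simp)
  then have "U \<in> pr T R" by (intro silting_pr_if_vanishing[OF fin KS R RU])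
  moreover have "Hom T U (Shift T X) = {0}"
    using Hom_zero_middle_source[OF t _ Hom_add_source[OF P XX1]] right_perpD[OF RX, of 1] by simp
  moreover have "Hom T U (Shift T U) = {0}"
    using Hom_zero_middle_source[OF t _ Hom_add_source[OF P XU]] right_perpD[OF RU, of 1] by simp
  ultimately show ?thesis using P t XU by blast
qed

lemma maximal_imp_silting:
  assumes fin: "Hom_finite T" and KS: "Krull_Schmidt T" and R: "silting T R"
    and M: "maximal_shift_rigid T R X"
  shows "silting T X"
proof -
  have pR: "presilting T R" using R unfolding silting_def by blast
  have X: "X \<in> pr T R" and sX: "shift_rigid T R X"
    using M unfolding maximal_shift_rigid_def by auto
  have pX: "presilting T X" using presilting_equivalences[OF pR X] sX by blast
  then have XX: "Hom T X (Shift T X) = {0}"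
    using presilting_equivalences[OF pR X] unfolding rigid_def by blast
  obtain U P where U: "U \<in> pr T R" "P \<in> add T X" "exact_triangle T R U P"
    and z: "Hom T X (Shift T U) = {0}" "Hom T U (Shift T X) = {0}" "Hom T U (Shift T U) = {0}"
    using bongartz_completion[OF fin KS R X pX] by blast
  have "Hom T Y (Shift T X \<oplus> Shift T U) = {0}" if "Y \<in> {X, U}" for Y
    by (rule Hom_direct_sum_target[OF dsum_direct_sum]) (use XX z that in auto)
  then have "Hom T (X \<oplus> U) (Shift T X \<oplus> Shift T U) = {0}"
    by (intro Hom_direct_sum_source[OF dsum_direct_sum]) simp
  then have "factoring T (Shift T R) (X \<oplus> U) (Shift T X \<oplus> Shift T U) = {0}"
    using factoring_subset_Hom zero_in_factoring by blast
  then have UX: "U \<in> add T X" using M U(1) unfolding maximal_shift_rigid_def by blast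
  have "C = UNIV" if C: "thick T C" "X \<in> C" for C
  proof -
    have "R \<in> C" using thick_cocone[OF C(1) U(3)] thick_add[OF C] UX U(2) by blast
    then have "thick_closure T R \<subseteq> C" unfolding thick_closure_def using C(1) by blast
    then show ?thesis using R unfolding silting_def by blast
  qed
  then have "thick_closure T X = UNIV" unfolding thick_closure_def by blast
  then show ?thesis unfolding silting_def using pX by blast
qed

end

theorem theorem3p4:
  fixes T :: "('k::alg_closed_field, 'o, 'm::ab_group_add) tri_cat"
    and R X :: 'o
  assumes "triangulated_category T"
    and "Hom_finite T"
    and "Krull_Schmidt T"
    and "X \<in> pr T R"
  shows "(presilting T R \<longrightarrow>
            (shift_rigid T R X \<longleftrightarrow> rigid T X) \<and> (rigid T X \<longleftrightarrow> presilting T X)) \<and>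
         (silting T R \<longrightarrow> (maximal_shift_rigid T R X \<longleftrightarrow> silting T X))"
proof -
  interpret triangulated_category T by fact
  show ?thesis
    using presilting_equivalences[OF _ assms(4)] maximal_imp_silting[OF assms(2,3)]
      silting_imp_maximal[OF assms(2,3) _ assms(4)]
    unfolding silting_def by blast
qed

end
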